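(* Let $\mathfrak g$ be a Borcherds algebra all of whose simple roots are imaginary (i.e. $I^{\mathrm{re}}=\emptyset$), with graph $G$, and let $\mathfrak n^+$ be the subalgebra generated by the $e_i$, $i\in I$. Let $q\in\mathbb N$. Then the Hilbert series of $\mathbf U(\mathfrak n^+)^{\otimes q}$ is $$H(\mathbf U(\mathfrak n^+)^{\otimes q})=\sum_{\alpha\in Q_+}(-1)^{\mathrm{ht}(\alpha)}\pi^G_\alpha(-q)\,e^\alpha .$$ In particular $\dim(\mathbf U(\mathfrak n^+)^{\otimes q})_\alpha=(-1)^{\mathrm{ht}(\alpha)}\pi^G_\alpha(-q)$ for all $\alpha\in Q_+$.
   Context: A Borcherds–Cartan matrix $A=(a_{ij})_{i,j\in I}$ ($I$ finite or countably infinite) is a real symmetrizable matrix with $a_{ii}=2$ or $a_{ii}\le0$, $a_{ij}\le0$ for $i\ne j$, $a_{ij}\in\mathbb Z$ if $a_{ii}=2$, and $a_{ij}=0\iff a_{ji}=0$. Here all $a_{ii}\le0$ (all simple roots imaginary), and the Borcherds algebra $\mathfrak g$ is the complex Lie algebra generated by $e_i,f_i,h_i$ with relations $[h_i,h_j]=0$, $[h_i,e_j]=a_{ij}e_j$, $[h_i,f_j]=-a_{ij}f_j$, $[e_i,f_j]=\delta_{ij}h_i$, and $[e_i,e_j]=0=[f_i,f_j]$ whenever $a_{ij}=0$. Its graph $G$ has vertex set $I$ and an edge between $i\ne j$ iff $a_{ij}\ne0$; a subset is independent if no two elements are adjacent. With formal symbols $\alpha_i$, $Q_+=\sum\mathbb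 Z_+\alpha_i$, $\mathrm{ht}(\sum n_i\alpha_i)=\sum n_i$; $\mathfrak n^+$ and its universal enveloping algebra are $Q_+$-graded with $e_i$ of degree $\alpha_i$, and $\mathbf U(\mathfrak n^+)^{\otimes q}$ carries the total grading. The Hilbert series of a $Q_+$-graded space $V$ with finite-dimensional pieces is $\sum_{\alpha}\dim V_\alpha e^\alpha$. We identify $\alpha=\sum k_i\alpha_i$ with the tuple $(k_i)$. For such a tuple, with $M(\alpha)$ the multiset containing $i$ exactly $k_i$ times and $P_m(\alpha,G)$ the set of ordered $m$-tuples of non-empty independent subsets of $I$ with multiset union $M(\alpha)$, the generalized chromatic polynomial is $\pi^G_\alpha(q)=\sum_{m\ge0}|P_m(\alpha,G)|\binom qm\in\mathbb Q[q]$ (so $\pi^G_0=1$), evaluated here at $-q$. *)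

theory Defs
  imports
    "Jordan_Normal_Form.VS_Connect"
    "HOL-Library.Multiset"
    "HOL-Computational_Algebra.Polynomial"
    "HOL-Library.Countable_Set"
begin

section \<open>Borcherds--Cartan matrices and their graphs\<close>

definition symmetrizable :: "'i set \<Rightarrow> ('i \<Rightarrow> 'i \<Rightarrow> real) \<Rightarrow> bool" where
  "symmetrizable I A \<longleftrightarrow>
     (\<exists>d :: 'i \<Rightarrow> real. (\<forall>i\<in>I. d i > 0) \<and> (\<forall>i\<in>I. \<forall>j\<in>I. d i * A i j = d j * A j i))"

definition borcherds_cartan_matrix :: "'i set \<Rightarrow> ('i \<Rightarrow> 'i \<Rightarrow> real) \<Rightarrow> bool" where
  "borcherds_cartan_matrix I A \<longleftrightarrow>
     countable I \<and> symmetrizable I A \<and>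
     (\<forall>i\<in>I. A i i = 2 \<or> A i i \<le> 0) \<and>
     (\<forall>i\<in>I. \<forall>j\<in>I. i \<noteq> j \<longrightarrow> A i j \<le> 0) \<and>
     (\<forall>i\<in>I. \<forall>j\<in>I. A i i = 2 \<longrightarrow> A i j \<in> \<int>) \<and>
     (\<forall>i\<in>I. \<forall>j\<in>I. A i j = 0 \<longleftrightarrow> A j i = 0)"

definition real_indices :: "'i set \<Rightarrow> ('i \<Rightarrow> 'i \<Rightarrow> real) \<Rightarrow> 'i set" where
  "real_indices I A = {i \<in> I. A i i = 2}"

definition graph_edges :: "'i set \<Rightarrow> ('i \<Rightarrow> 'i \<Rightarrow> real) \<Rightarrow> 'i set set" where
  "graph_edges I A = {{i, j} | i j. i \<in> I \<and> j \<in> I \<and> i \<noteq> j \<and> A i j \<noteq> 0}"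

definition independent_set :: "'i set \<Rightarrow> 'i set set \<Rightarrow> 'i set \<Rightarrow> bool" where
  "independent_set V E S \<longleftrightarrow> S \<subseteq> V \<and> (\<forall>i\<in>S. \<forall>j\<in>S. {i, j} \<notin> E)"


section \<open>The monoid $Q_+$ and the generalized chromatic polynomial\<close>

text \<open>An element $\sum_i k_i \alpha_i$ of $Q_+$ is represented by the multiset $M(\alpha)$ that
  contains $i$ exactly $k_i$ times; so $\alpha_i$ is \<open>{#i#}\<close>, the sum is multiset union, and
  the height is \<open>size\<close>.\<close>

definition Q_plus :: "'i set \<Rightarrow> 'i multiset set" where
  "Q_plus I = {\<alpha>. set_mset \<alpha> \<subseteq> I}"

text \<open>The finiteness condition is implied by the mathematical multiset union being the finite
  multiset \<open>\<alpha>\<close>; it has to be explicit since \<open>mset_set\<close> is empty on infinite sets.\<close>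

definition indep_tuples :: "'i set \<Rightarrow> 'i set set \<Rightarrow> nat \<Rightarrow> 'i multiset \<Rightarrow> 'i set list set" where
  "indep_tuples V E m \<alpha> =
     {Ss. length Ss = m \<and>
          (\<forall>S\<in>set Ss. S \<noteq> {} \<and> finite S \<and> independent_set V E S) \<and>
          (\<Sum>S\<leftarrow>Ss. mset_set S) = \<alpha>}"

definition binomial_poly :: "nat \<Rightarrow> rat poly" where
  "binomial_poly m = Polynomial.smult (1 / fact m) (\<Prod>k<m. [:- of_nat k, 1:])"

text \<open>The sum over all $m \ge 0$ stops at \<open>m = size \<alpha>\<close>: the parts of a tuple are non-empty, so
  there are no tuples for larger $m$.\<close>

definition gen_chromatic_poly :: "'i set \<Rightarrow> 'i set set \<Rightarrow> 'i multiset \<Rightarrow> rat poly" where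
  "gen_chromatic_poly V E \<alpha> =
     (\<Sum>m\<le>size \<alpha>. Polynomial.smult (of_nat (card (indep_tuples V E m \<alpha>))) (binomial_poly m))"


section \<open>Complex algebras given by generators and identities\<close>

datatype 'x alg_term =
    Gen 'x | Zero | One
  | Add "'x alg_term" "'x alg_term"
  | Smult complex "'x alg_term"
  | Mult "'x alg_term" "'x alg_term"

text \<open>The terms over the generators \<open>X\<close> that are available in a vector space, in a Lie algebra
  (where \<open>Mult\<close> is the bracket), and in a unital associative algebra.\<close>

inductive_set linear_terms :: "'x set \<Rightarrow> 'x alg_term set" for X where
  "x \<in> X \<Longrightarrow> Gen x \<in> linear_terms X"
| "Zero \<in> linear_terms X"
| "s \<in> linear_terms X \<Longrightarrow> t \<in> linear_terms X \<Longrightarrow> Add s t \<in> linear_terms X"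
| "t \<in> linear_terms X \<Longrightarrow> Smult c t \<in> linear_terms X"

inductive_set lie_terms :: "'x set \<Rightarrow> 'x alg_term set" for X where
  "x \<in> X \<Longrightarrow> Gen x \<in> lie_terms X"
| "Zero \<in> lie_terms X"
| "s \<in> lie_terms X \<Longrightarrow> t \<in> lie_terms X \<Longrightarrow> Add s t \<in> lie_terms X"
| "t \<in> lie_terms X \<Longrightarrow> Smult c t \<in> lie_terms X"
| "s \<in> lie_terms X \<Longrightarrow> t \<in> lie_terms X \<Longrightarrow> Mult s t \<in> lie_terms X"

definition assoc_terms :: "'x set \<Rightarrow> 'x alg_term set" where
  "assoc_terms X = {t. set_alg_term t \<subseteq> X}"

inductive_set vector_space_ids :: "('x alg_term \<times> 'x alg_term) set" where
  "(Add (Add r s) t, Add r (Add s t)) \<in> vector_space_ids"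
| "(Add s t, Add t s) \<in> vector_space_ids"
| "(Add Zero t, t) \<in> vector_space_ids"
| "(Smult 0 t, Zero) \<in> vector_space_ids"
| "(Smult 1 t, t) \<in> vector_space_ids"
| "(Smult c (Smult d t), Smult (c * d) t) \<in> vector_space_ids"
| "(Smult (c + d) t, Add (Smult c t) (Smult d t)) \<in> vector_space_ids"
| "(Smult c (Add s t), Add (Smult c s) (Smult c t)) \<in> vector_space_ids"

inductive_set bilinear_ids :: "('x alg_term \<times> 'x alg_term) set" where
  "(Mult (Add r s) t, Add (Mult r t) (Mult s t)) \<in> bilinear_ids"
| "(Mult r (Add s t), Add (Mult r s) (Mult r t)) \<in> bilinear_ids"
| "(Mult (Smult c s) t, Smult c (Mult s t)) \<in> bilinear_ids"
| "(Mult s (Smult c t), Smult c (Mult s t)) \<in> bilinear_ids"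

inductive_set lie_ids :: "('x alg_term \<times> 'x alg_term) set" where
  "(Mult t t, Zero) \<in> lie_ids"
| "(Add (Mult r (Mult s t)) (Add (Mult s (Mult t r)) (Mult t (Mult r s))), Zero) \<in> lie_ids"

inductive_set assoc_ids :: "('x alg_term \<times> 'x alg_term) set" where
  "(Mult (Mult r s) t, Mult r (Mult s t)) \<in> assoc_ids"
| "(Mult One t, t) \<in> assoc_ids"
| "(Mult t One, t) \<in> assoc_ids"

text \<open>The least congruence on the set of terms \<open>T\<close> that contains the identities \<open>E\<close>.\<close>

inductive term_cong :: "'x alg_term set \<Rightarrow> ('x alg_term \<times> 'x alg_term) set \<Rightarrow>
    'x alg_term \<Rightarrow> 'x alg_term \<Rightarrow> bool" for T E where
  ident: "(s, t) \<in> E \<Longrightarrow> s \<in> T \<Longrightarrow> t \<in> T \<Longrightarrow> term_cong T E s t"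
| refl: "t \<in> T \<Longrightarrow> term_cong T E t t"
| sym: "term_cong T E s t \<Longrightarrow> term_cong T E t s"
| trans: "term_cong T E r s \<Longrightarrow> term_cong T E s t \<Longrightarrow> term_cong T E r t"
| add: "term_cong T E s s' \<Longrightarrow> term_cong T E t t' \<Longrightarrow> Add s t \<in> T \<Longrightarrow> Add s' t' \<in> T \<Longrightarrow>
    term_cong T E (Add s t) (Add s' t')"
| smult: "term_cong T E t t' \<Longrightarrow> Smult c t \<in> T \<Longrightarrow> Smult c t' \<in> T \<Longrightarrow>
    term_cong T E (Smult c t) (Smult c t')"
| mult: "term_cong T E s s' \<Longrightarrow> term_cong T E t t' \<Longrightarrow> Mult s t \<in> T \<Longrightarrow> Mult s' t' \<in> T \<Longrightarrow>
    term_cong T E (Mult s t) (Mult s' t')"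

definition term_class ::
    "'x alg_term set \<Rightarrow> ('x alg_term \<times> 'x alg_term) set \<Rightarrow> 'x alg_term \<Rightarrow> 'x alg_term set" where
  "term_class T E t = {u. term_cong T E t u}"

text \<open>The quotient is presented as a \<open>module\<close> record. The fields \<open>mult\<close> and \<open>one\<close> carry no
  meaning when \<open>T\<close> is not closed under \<open>Mult\<close> or does not contain \<open>One\<close>.\<close>

definition presented_algebra ::
    "'x alg_term set \<Rightarrow> ('x alg_term \<times> 'x alg_term) set \<Rightarrow> (complex, 'x alg_term set) module" where
  "presented_algebra T E =
     \<lparr>carrier = term_class T E ` T,
      mult = (\<lambda>P Q. {u. \<exists>s\<in>P. \<exists>t\<in>Q. term_cong T E (Mult s t) u}),
      one = term_class T E One,
      zero = term_class T E Zero,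
      add = (\<lambda>P Q. {u. \<exists>s\<in>P. \<exists>t\<in>Q. term_cong T E (Add s t) u}),
      smult = (\<lambda>c P. {u. \<exists>t\<in>P. term_cong T E (Smult c t) u})\<rparr>"


section \<open>The Borcherds algebra and $\mathfrak n^+$\<close>

datatype 'i chevalley_gen = e_gen 'i | f_gen 'i | h_gen 'i

definition chevalley_gens :: "'i set \<Rightarrow> 'i chevalley_gen set" where
  "chevalley_gens I = e_gen ` I \<union> f_gen ` I \<union> h_gen ` I"

text \<open>The Serre relations attached to real simple roots are not listed: these relations define the
  Borcherds algebra in the case \<open>real_indices I A = {}\<close> only.\<close>

inductive_set borcherds_rels ::
    "'i set \<Rightarrow> ('i \<Rightarrow> 'i \<Rightarrow> real) \<Rightarrow> ('i chevalley_gen alg_term \<times> 'i chevalley_gen alg_term) set"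
  for I A where
  "i \<in> I \<Longrightarrow> j \<in> I \<Longrightarrow> (Mult (Gen (h_gen i)) (Gen (h_gen j)), Zero) \<in> borcherds_rels I A"
| "i \<in> I \<Longrightarrow> j \<in> I \<Longrightarrow>
    (Mult (Gen (h_gen i)) (Gen (e_gen j)), Smult (complex_of_real (A i j)) (Gen (e_gen j)))
      \<in> borcherds_rels I A"
| "i \<in> I \<Longrightarrow> j \<in> I \<Longrightarrow>
    (Mult (Gen (h_gen i)) (Gen (f_gen j)), Smult (complex_of_real (- A i j)) (Gen (f_gen j)))
      \<in> borcherds_rels I A"
| "i \<in> I \<Longrightarrow> j \<in> I \<Longrightarrow>
    (Mult (Gen (e_gen i)) (Gen (f_gen j)), if i = j then Gen (h_gen i) else Zero)
      \<in> borcherds_rels I A"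
| "i \<in> I \<Longrightarrow> j \<in> I \<Longrightarrow> A i j = 0 \<Longrightarrow>
    (Mult (Gen (e_gen i)) (Gen (e_gen j)), Zero) \<in> borcherds_rels I A"
| "i \<in> I \<Longrightarrow> j \<in> I \<Longrightarrow> A i j = 0 \<Longrightarrow>
    (Mult (Gen (f_gen i)) (Gen (f_gen j)), Zero) \<in> borcherds_rels I A"

definition borcherds_ids ::
    "'i set \<Rightarrow> ('i \<Rightarrow> 'i \<Rightarrow> real) \<Rightarrow> ('i chevalley_gen alg_term \<times> 'i chevalley_gen alg_term) set" where
  "borcherds_ids I A = vector_space_ids \<union> bilinear_ids \<union> lie_ids \<union> borcherds_rels I A"

definition borcherds_algebra ::
    "'i set \<Rightarrow> ('i \<Rightarrow> 'i \<Rightarrow> real) \<Rightarrow> (complex, 'i chevalley_gen alg_term set) module" where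
  "borcherds_algebra I A = presented_algebra (lie_terms (chevalley_gens I)) (borcherds_ids I A)"

definition chevalley_e ::
    "'i set \<Rightarrow> ('i \<Rightarrow> 'i \<Rightarrow> real) \<Rightarrow> 'i \<Rightarrow> 'i chevalley_gen alg_term set" where
  "chevalley_e I A i =
     term_class (lie_terms (chevalley_gens I)) (borcherds_ids I A) (Gen (e_gen i))"

inductive_set generated_subalgebra :: "(complex, 'a) module \<Rightarrow> 'a set \<Rightarrow> 'a set" for L X where
  "x \<in> X \<Longrightarrow> x \<in> generated_subalgebra L X"
| "\<zero>\<^bsub>L\<^esub> \<in> generated_subalgebra L X"
| "x \<in> generated_subalgebra L X \<Longrightarrow> y \<in> generated_subalgebra L X \<Longrightarrow>
    x \<oplus>\<^bsub>L\<^esub> y \<in> generated_subalgebra L X"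
| "x \<in> generated_subalgebra L X \<Longrightarrow> c \<odot>\<^bsub>L\<^esub> x \<in> generated_subalgebra L X"
| "x \<in> generated_subalgebra L X \<Longrightarrow> y \<in> generated_subalgebra L X \<Longrightarrow>
    x \<otimes>\<^bsub>L\<^esub> y \<in> generated_subalgebra L X"

definition n_plus ::
    "'i set \<Rightarrow> ('i \<Rightarrow> 'i \<Rightarrow> real) \<Rightarrow> (complex, 'i chevalley_gen alg_term set) module" where
  "n_plus I A = (borcherds_algebra I A)
     \<lparr>carrier := generated_subalgebra (borcherds_algebra I A) (chevalley_e I A ` I)\<rparr>"


section \<open>Universal enveloping algebras and tensor powers\<close>

text \<open>The unital associative algebra generated by the vector space \<open>L\<close> subject to
  $xy - yx = [x, y]$, i.e. the tensor algebra of \<open>L\<close> modulo these relations.\<close>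

inductive_set enveloping_rels :: "(complex, 'a) module \<Rightarrow> ('a alg_term \<times> 'a alg_term) set"
  for L where
  "x \<in> carrier L \<Longrightarrow> y \<in> carrier L \<Longrightarrow>
    (Gen (x \<oplus>\<^bsub>L\<^esub> y), Add (Gen x) (Gen y)) \<in> enveloping_rels L"
| "x \<in> carrier L \<Longrightarrow> (Gen (c \<odot>\<^bsub>L\<^esub> x), Smult c (Gen x)) \<in> enveloping_rels L"
| "x \<in> carrier L \<Longrightarrow> y \<in> carrier L \<Longrightarrow>
    (Add (Mult (Gen x) (Gen y)) (Smult (- 1) (Mult (Gen y) (Gen x))), Gen (x \<otimes>\<^bsub>L\<^esub> y))
      \<in> enveloping_rels L"

definition enveloping_ids :: "(complex, 'a) module \<Rightarrow> ('a alg_term \<times> 'a alg_term) set" where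
  "enveloping_ids L = vector_space_ids \<union> bilinear_ids \<union> assoc_ids \<union> enveloping_rels L"

definition enveloping_algebra :: "(complex, 'a) module \<Rightarrow> (complex, 'a alg_term set) module" where
  "enveloping_algebra L = presented_algebra (assoc_terms (carrier L)) (enveloping_ids L)"

definition enveloping_map :: "(complex, 'a) module \<Rightarrow> 'a \<Rightarrow> 'a alg_term set" where
  "enveloping_map L x = term_class (assoc_terms (carrier L)) (enveloping_ids L) (Gen x)"

text \<open>The \<open>q\<close>-th tensor power over the complex numbers is generated by the lists
  $[x_1, \dots, x_q]$, which stand for $x_1 \otimes \dots \otimes x_q$, subject to
  multilinearity.\<close>

definition tensor_gens :: "nat \<Rightarrow> (complex, 'a) module \<Rightarrow> 'a list set" where
  "tensor_gens q V = {xs. length xs = q \<and> set xs \<subseteq> carrier V}"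

inductive_set tensor_rels ::
    "nat \<Rightarrow> (complex, 'a) module \<Rightarrow> ('a list alg_term \<times> 'a list alg_term) set" for q V where
  "xs \<in> tensor_gens q V \<Longrightarrow> k < q \<Longrightarrow> x \<in> carrier V \<Longrightarrow> y \<in> carrier V \<Longrightarrow>
    (Gen (xs[k := x \<oplus>\<^bsub>V\<^esub> y]), Add (Gen (xs[k := x])) (Gen (xs[k := y]))) \<in> tensor_rels q V"
| "xs \<in> tensor_gens q V \<Longrightarrow> k < q \<Longrightarrow> x \<in> carrier V \<Longrightarrow>
    (Gen (xs[k := c \<odot>\<^bsub>V\<^esub> x]), Smult c (Gen (xs[k := x]))) \<in> tensor_rels q V"

definition tensor_power ::
    "nat \<Rightarrow> (complex, 'a) module \<Rightarrow> (complex, 'a list alg_term set) module" where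
  "tensor_power q V =
     presented_algebra (linear_terms (tensor_gens q V)) (vector_space_ids \<union> tensor_rels q V)"

definition pure_tensor :: "nat \<Rightarrow> (complex, 'a) module \<Rightarrow> 'a list \<Rightarrow> 'a list alg_term set" where
  "pure_tensor q V xs =
     term_class (linear_terms (tensor_gens q V)) (vector_space_ids \<union> tensor_rels q V) (Gen xs)"


section \<open>Gradings and Hilbert series\<close>

text \<open>The graded components of an algebra (Lie or associative) that is generated by elements \<open>x\<close>
  of prescribed degrees \<open>\<alpha>\<close>, for \<open>(x, \<alpha>) \<in> X\<close>: the smallest family of subspaces that contains
  the generators in their degrees and for which degrees add up in products.\<close>

inductive homogeneous :: "(complex, 'a) module \<Rightarrow> ('a \<times> 'i multiset) set \<Rightarrow> 'i multiset \<Rightarrow> 'a \<Rightarrow> bool"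
  for M X where
  "(x, \<alpha>) \<in> X \<Longrightarrow> homogeneous M X \<alpha> x"
| "homogeneous M X \<alpha> \<zero>\<^bsub>M\<^esub>"
| "homogeneous M X \<alpha> x \<Longrightarrow> homogeneous M X \<alpha> y \<Longrightarrow> homogeneous M X \<alpha> (x \<oplus>\<^bsub>M\<^esub> y)"
| "homogeneous M X \<alpha> x \<Longrightarrow> homogeneous M X \<alpha> (c \<odot>\<^bsub>M\<^esub> x)"
| "homogeneous M X \<alpha> x \<Longrightarrow> homogeneous M X \<beta> y \<Longrightarrow> homogeneous M X (\<alpha> + \<beta>) (x \<otimes>\<^bsub>M\<^esub> y)"

definition n_plus_part ::
    "'i set \<Rightarrow> ('i \<Rightarrow> 'i \<Rightarrow> real) \<Rightarrow> 'i multiset \<Rightarrow> 'i chevalley_gen alg_term set set" where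
  "n_plus_part I A \<alpha> = {x. homogeneous (n_plus I A) {(chevalley_e I A i, {#i#}) | i. i \<in> I} \<alpha> x}"

definition enveloping_part ::
    "(complex, 'a) module \<Rightarrow> ('i multiset \<Rightarrow> 'a set) \<Rightarrow> 'i multiset \<Rightarrow> 'a alg_term set set" where
  "enveloping_part L D \<alpha> =
     {u. homogeneous (enveloping_algebra L)
           (insert (\<one>\<^bsub>enveloping_algebra L\<^esub>, {#}) {(enveloping_map L x, \<beta>) | x \<beta>. x \<in> D \<beta>}) \<alpha> u}"

definition tensor_part ::
    "nat \<Rightarrow> (complex, 'a) module \<Rightarrow> ('i multiset \<Rightarrow> 'a set) \<Rightarrow> 'i multiset \<Rightarrow>
      'a list alg_term set set" where
  "tensor_part q V D \<alpha> =
     LinearCombinations.module.span class_ring (tensor_power q V)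
       {pure_tensor q V xs | xs \<beta>s.
          length xs = q \<and> length \<beta>s = q \<and> (\<forall>k<q. xs ! k \<in> D (\<beta>s ! k)) \<and> sum_list \<beta>s = \<alpha>}"

definition graded_component ::
    "(complex, 'a) module \<Rightarrow> ('i multiset \<Rightarrow> 'a set) \<Rightarrow> 'i multiset \<Rightarrow> (complex, 'a) module" where
  "graded_component V D \<alpha> = V\<lparr>carrier := D \<alpha>\<rparr>"

text \<open>A formal series $\sum_{\alpha \in Q_+} c_\alpha e^\alpha$ is the function
  $\alpha \mapsto c_\alpha$ on $Q_+$ (extensional outside of $Q_+$).\<close>

definition hilbert_series ::
    "'i set \<Rightarrow> (complex, 'a) module \<Rightarrow> ('i multiset \<Rightarrow> 'a set) \<Rightarrow> 'i multiset \<Rightarrow> rat" where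
  "hilbert_series I V D =
     (\<lambda>\<alpha>\<in>Q_plus I. of_nat (vectorspace.dim class_ring (graded_component V D \<alpha>)))"

definition U_tensor ::
    "'i set \<Rightarrow> ('i \<Rightarrow> 'i \<Rightarrow> real) \<Rightarrow> nat \<Rightarrow>
      (complex, 'i chevalley_gen alg_term set alg_term set list alg_term set) module" where
  "U_tensor I A q = tensor_power q (enveloping_algebra (n_plus I A))"

definition U_tensor_part ::
    "'i set \<Rightarrow> ('i \<Rightarrow> 'i \<Rightarrow> real) \<Rightarrow> nat \<Rightarrow> 'i multiset \<Rightarrow>
      'i chevalley_gen alg_term set alg_term set list alg_term set set" where
  "U_tensor_part I A q =
     tensor_part q (enveloping_algebra (n_plus I A))
       (enveloping_part (n_plus I A) (n_plus_part I A))"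

end

theory Submission
  imports Defs
begin

text \<open>The algebra $\mathbf U(\mathfrak n^+)$ is spanned by the words in the $e_i$, and letters with
  $a_{ij} = 0$ commute; so it is a quotient of the algebra of the free partially commutative monoid
  of traces. There is no further collapse, since $\mathfrak g$ acts on that algebra as on its Verma
  module of lowest weight $0$, where $e_i$ is left multiplication by $i$. Thus $q$-tuples of traces
  form a basis of the $q$-th tensor power. By Cartier and Foata, the generating function of the
  traces is $(1 + z)^{-1}$ with $z = \sum_{S \ne \emptyset} (-1)^{|S|} e^S$ over the independent
  sets $S$, and the coefficients of $z^m$ are $(-1)^{\mathrm{ht}(\alpha)} |P_m(\alpha, G)|$; now
  expand $(1 + z)^{-q}$.\<close>


section \<open>Traces and tuples of cliques\<close>

text \<open>The delicate half is the independence of distinct traces. Since n^+ is cut out of g and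
  not presented by itself, a relation between words in the e_i might arise in g by a detour through
  the f_i and h_i. Linear forms that separate traces must therefore come from a module over all of
  g, and making the f_i act is the real content. All algebras are sets of congruence classes of
  terms, so a map out of one is a recursion over terms that respects every identity, evaluated at a
  chosen representative. In such recursions arbitrary functions of words are easier to handle than
  formal sums of traces; hence the dual. For q factors, products of indicator functions of traces
  are dual to the candidate basis, which gives distinctness and independence at once. On the
  counting side no power series are formed: multiplication by 1 + z appears as a signed sum over
  cliques that lowers q by one.\<close>

lemma sum_minus_one_power_card_Pow:
  assumes "finite F"
  shows "(\<Sum>S\<in>Pow F. (- 1) ^ card S) = (if F = {} then 1 else 0 :: 'a::comm_ring_1)"
  using assms
proof (induction F)
  case (insert x F)
  have "inj_on (insert x) (Pow F)"
    using insert.hyps by (auto simp: inj_on_def)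
  moreover have "Pow F \<inter> insert x ` Pow F = {}"
    using insert.hyps by auto
  ultimately have "(\<Sum>S\<in>Pow (insert x F). (- 1) ^ card S) =
      (\<Sum>S\<in>Pow F. (- 1) ^ card S) + (\<Sum>S\<in>Pow F. (- 1 :: 'a) ^ card (insert x S))"
    using insert.hyps by (simp add: Pow_insert sum.union_disjoint sum.reindex)
  also have "(\<Sum>S\<in>Pow F. (- 1 :: 'a) ^ card (insert x S)) = (\<Sum>S\<in>Pow F. - ((- 1) ^ card S))"
  proof (rule sum.cong)
    fix S assume "S \<in> Pow F"
    then have "x \<notin> S" "finite S" using insert.hyps by (auto intro: finite_subset)
    then show "(- 1 :: 'a) ^ card (insert x S) = - ((- 1) ^ card S)" by simp
  qed simp
  finally show ?case by (simp add: sum_negf)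
qed simp

lemma mset_set_subseteq: "finite S \<Longrightarrow> S \<subseteq> set_mset \<alpha> \<Longrightarrow> mset_set S \<subseteq># \<alpha>"
  by (rule mset_subset_eqI) (auto simp: count_mset_set')

lemma mset_subseteq_sum_list: "w \<in> set ws \<Longrightarrow> f w \<subseteq># (\<Sum>w\<leftarrow>ws. f w)" for f :: "'b \<Rightarrow> 'a multiset"
  by (induction ws) (auto simp: subset_mset.add_increasing subset_mset.add_increasing2)

lemma poly_binomial_poly: "poly (binomial_poly m) x = x gchoose m"
  by (simp add: binomial_poly_def poly_prod gbinomial_prod_rev atLeast0LessThan)

section \<open>The free partially commutative monoid\<close>

locale commutation =
  fixes D :: "'i \<Rightarrow> 'i \<Rightarrow> bool"
  assumes D_sym: "D i j \<Longrightarrow> D j i"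
    and D_irrefl: "\<not> D i i"
begin

inductive swap :: "'i list \<Rightarrow> 'i list \<Rightarrow> bool" where
  "D i j \<Longrightarrow> swap (u @ i # j # v) (u @ j # i # v)"

abbreviation trace_eq :: "'i list \<Rightarrow> 'i list \<Rightarrow> bool" (infix "\<approx>" 50) where
  "trace_eq \<equiv> swap\<^sup>*\<^sup>*"

lemma swap_sym: "swap u v \<Longrightarrow> swap v u"
  by (metis D_sym swap.simps)

lemma trace_eq_sym: "u \<approx> v \<Longrightarrow> v \<approx> u"
  by (metis swap_sym symp_def symp_rtranclp)

lemma swap_Cons: "swap u v \<Longrightarrow> swap (i # u) (i # v)"
  by (metis append_Cons swap.simps)

lemma trace_eq_Cons: "u \<approx> v \<Longrightarrow> i # u \<approx> i # v"
  by (induction rule: rtranclp_induct) (auto intro: swap_Cons rtranclp.rtrancl_into_rtrancl)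

lemma trace_eq_mset: "u \<approx> v \<Longrightarrow> mset u = mset v"
  by (induction rule: rtranclp_induct) (auto elim!: swap.cases)

lemma trace_eq_Nil [simp]: "[] \<approx> v \<longleftrightarrow> v = []"
  using trace_eq_mset by fastforce

text \<open>Only the first occurrence is deleted, and equal letters never pass each other, so a swap
  does not change which letter is deleted. This makes left cancellation well defined on
  traces.\<close>

lemma swap_remove1: "swap u v \<Longrightarrow> remove1 i u \<approx> remove1 i v"
proof (induction rule: swap.induct)
  case (1 j k u v)
  then have "j \<noteq> k" using D_irrefl by auto
  then show ?case
    using 1 by (auto simp: remove1_append intro!: r_into_rtranclp swap.intros)
qed

lemma trace_eq_remove1: "u \<approx> v \<Longrightarrow> remove1 i u \<approx> remove1 i v"
  by (induction rule: rtranclp_induct) (auto intro: swap_remove1 rtranclp_trans)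

text \<open>A recursive test for whether \<open>i\<close> can be moved to the front: its first
  occurrence commutes with every letter before it. That the test is right follows from
  \<open>initial_front\<close> and \<open>initial_trace_eq\<close>.\<close>

primrec initial :: "'i \<Rightarrow> 'i list \<Rightarrow> bool" where
  "initial i [] \<longleftrightarrow> False"
| "initial i (j # w) \<longleftrightarrow> i = j \<or> D i j \<and> initial i w"

lemma initial_swap: "swap u v \<Longrightarrow> initial i u = initial i v"
proof (induction rule: swap.induct)
  case (1 j k u v)
  then show ?case by (induction u) (auto dest: D_sym)
qed

lemma initial_trace_eq: "u \<approx> v \<Longrightarrow> initial i u = initial i v"
  by (induction rule: rtranclp_induct) (auto simp: initial_swap)

lemma initial_in_set: "initial i w \<Longrightarrow> i \<in> set w"
  by (induction w) auto

text \<open>Of two distinct initial letters, the one that occurs later must pass the other. Hence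
  the initial letters of a trace form a clique.\<close>

lemma initial_commute: "initial i w \<Longrightarrow> initial j w \<Longrightarrow> i \<noteq> j \<Longrightarrow> D i j"
  by (induction w) (auto dest: D_sym)

lemma initial_front: "initial i w \<Longrightarrow> w \<approx> i # remove1 i w"
proof (induction w)
  case (Cons j w)
  show ?case
  proof (cases "i = j")
    case False
    then have "D i j" "w \<approx> i # remove1 i w" using Cons by auto
    then have "j # w \<approx> j # i # remove1 i w" by (simp add: trace_eq_Cons)
    moreover have "swap (j # i # remove1 i w) (i # j # remove1 i w)"
      using swap.intros[of j i "[]"] \<open>D i j\<close> by (simp add: D_sym)
    ultimately show ?thesis using False by auto
  qed simp
qed simp

lemma initial_all_empty: "{i. initial i w} = {} \<longleftrightarrow> w = []"
  by (cases w) auto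

text \<open>An arbitrary representative of the class. It depends only on the predicate
  \<open>\<lambda>v. w \<approx> v\<close>, which equivalent words share.\<close>

definition nf :: "'i list \<Rightarrow> 'i list" where
  "nf w = (SOME v. w \<approx> v)"

lemma trace_eq_nf: "w \<approx> nf w"
  unfolding nf_def by (rule someI[of _ w]) simp

lemma nf_eq_iff: "nf u = nf v \<longleftrightarrow> u \<approx> v"
proof
  assume "u \<approx> v"
  then have "(\<lambda>w. u \<approx> w) = (\<lambda>w. v \<approx> w)"
    by (metis rtranclp_trans trace_eq_sym)
  then show "nf u = nf v" by (simp add: nf_def)
qed (metis rtranclp_trans trace_eq_nf trace_eq_sym)

lemma nf_idem [simp]: "nf (nf w) = nf w"
  by (metis nf_eq_iff trace_eq_nf)

lemma mset_nf [simp]: "mset (nf w) = mset w"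
  by (metis trace_eq_mset trace_eq_nf)

lemma nf_Nil [simp]: "nf [] = []"
  by (metis trace_eq_nf trace_eq_Nil)

lemma initial_nf [simp]: "initial i (nf w) = initial i w"
  by (metis initial_trace_eq trace_eq_nf)

lemma nf_Cons_nf [simp]: "nf (i # nf w) = nf (i # w)"
  by (metis nf_eq_iff trace_eq_Cons trace_eq_nf trace_eq_sym)

lemma nf_remove1_nf [simp]: "nf (remove1 i (nf w)) = nf (remove1 i w)"
  by (metis nf_eq_iff trace_eq_remove1 trace_eq_nf trace_eq_sym)

text \<open>Traces, i.e. the elements of the free partially commutative monoid, are represented by
  their normal words.\<close>

definition trace_lists :: "nat \<Rightarrow> 'i multiset \<Rightarrow> 'i list list set" where
  "trace_lists q \<alpha> = {ws. length ws = q \<and> (\<forall>w\<in>set ws. nf w = w) \<and> (\<Sum>w\<leftarrow>ws. mset w) = \<alpha>}"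

text \<open>The empty clique is included: it carries the unknown term in the recursions below.
  Confinement to the support of \<open>\<alpha>\<close> keeps the sums finite and the differences
  \<open>\<alpha> - mset_set S\<close> untruncated.\<close>

definition cliques :: "'i multiset \<Rightarrow> 'i set set" where
  "cliques \<alpha> = {S. S \<subseteq> set_mset \<alpha> \<and> pairwise D S}"

lemma finite_cliques [simp]: "finite (cliques \<alpha>)"
  unfolding cliques_def by (rule finite_subset[of _ "Pow (set_mset \<alpha>)"]) auto

lemma finite_clique: "S \<in> cliques \<alpha> \<Longrightarrow> finite S"
  by (auto simp: cliques_def intro: finite_subset)

lemma empty_in_cliques [simp]: "{} \<in> cliques \<alpha>"
  by (simp add: cliques_def)

lemma mset_set_clique: "S \<in> cliques \<alpha> \<Longrightarrow> mset_set S \<subseteq># \<alpha>"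
  using finite_clique mset_set_subseteq by (auto simp: cliques_def)

lemma finite_trace_lists [simp]: "finite (trace_lists q \<alpha>)"
proof (rule finite_subset)
  show "trace_lists q \<alpha> \<subseteq> {ws. set ws \<subseteq> {w. set w \<subseteq> set_mset \<alpha> \<and> length w \<le> size \<alpha>} \<and> length ws = q}"
    unfolding trace_lists_def
    using mset_subseteq_sum_list[of _ _ mset]
    by (fastforce dest: set_mset_mono size_mset_mono)
  show "finite {ws. set ws \<subseteq> {w. set w \<subseteq> set_mset \<alpha> \<and> length w \<le> size \<alpha>} \<and> length ws = q}"
    by (intro finite_lists_length_eq finite_lists_length_le) simp
qed

lemma trace_lists_0: "trace_lists 0 \<alpha> = (if \<alpha> = {#} then {[]} else {})"
  by (auto simp: trace_lists_def)

text \<open>Deleting \<open>i\<close> from the first trace is inverse to prepending it. The letters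
  of \<open>S\<close> commute with \<open>i\<close>, so they stay initial in both
  directions.\<close>

lemma card_trace_lists_initial_insert:
  assumes "i \<in># \<alpha>" "\<And>j. j \<in> S \<Longrightarrow> D i j"
  shows "card {ws \<in> trace_lists (Suc q) \<alpha>. \<forall>j\<in>insert i S. initial j (hd ws)} =
    card {ws \<in> trace_lists (Suc q) (\<alpha> - {#i#}). \<forall>j\<in>S. initial j (hd ws)}"
    (is "card ?L = card ?R")
proof (rule card_bij_eq)
  let ?f = "\<lambda>ws. nf (remove1 i (hd ws)) # tl ws" and ?g = "\<lambda>ws. nf (i # hd ws) # tl ws"
  have S: "j \<noteq> i" "D j i" if "j \<in> S" for j
    using assms(2)[OF that] D_irrefl D_sym by auto
  have gf: "?g (?f ws) = ws" and f: "?f ws \<in> ?R" if ws: "ws \<in> ?L" for ws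
  proof -
    obtain w vs where [simp]: "ws = w # vs"
      using ws by (cases ws) (auto simp: trace_lists_def)
    have w: "initial i w" "nf w = w" and vs: "\<forall>v\<in>set vs. nf v = v" "length vs = q"
      and sum: "mset w + (\<Sum>v\<leftarrow>vs. mset v) = \<alpha>" and init: "\<forall>j\<in>S. initial j w"
      using ws by (auto simp: trace_lists_def)
    have front: "nf (i # remove1 i w) = w"
      using initial_front[OF w(1)] w(2) by (metis nf_eq_iff trace_eq_sym)
    then show "?g (?f ws) = ws" by simp
    have "initial j (remove1 i w)" if "j \<in> S" for j
    proof -
      have "initial j (i # remove1 i w)"
        using init that front by (metis initial_nf)
      then show ?thesis using S that by simp
    qed
    moreover have "mset w - {#i#} + (\<Sum>v\<leftarrow>vs. mset v) = \<alpha> - {#i#}"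
      using sum initial_in_set[OF w(1)] by (metis add.commute diff_union_single_conv set_mset_mset)
    ultimately show "?f ws \<in> ?R"
      using vs by (auto simp: trace_lists_def)
  qed
  have fg: "?f (?g ws) = ws" and g: "?g ws \<in> ?L" if ws: "ws \<in> ?R" for ws
  proof -
    obtain w vs where [simp]: "ws = w # vs"
      using ws by (cases ws) (auto simp: trace_lists_def)
    have w: "nf w = w" and vs: "\<forall>v\<in>set vs. nf v = v" "length vs = q"
      and sum: "mset w + (\<Sum>v\<leftarrow>vs. mset v) = \<alpha> - {#i#}" and init: "\<forall>j\<in>S. initial j w"
      using ws by (auto simp: trace_lists_def)
    show "?f (?g ws) = ws" using w by simp
    have "add_mset i (mset w + (\<Sum>v\<leftarrow>vs. mset v)) = \<alpha>"
      using sum assms(1) by simp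
    then show "?g ws \<in> ?L"
      using vs init S by (auto simp: trace_lists_def)
  qed
  show "inj_on ?f ?L" using gf by (rule inj_on_inverseI)
  show "?f ` ?L \<subseteq> ?R" using f by auto
  show "inj_on ?g ?R" using fg by (rule inj_on_inverseI)
  show "?g ` ?R \<subseteq> ?L" using g by auto
qed simp_all

lemma card_trace_lists_initial:
  assumes "finite S" "S \<in> cliques \<alpha>"
  shows "card {ws \<in> trace_lists (Suc q) \<alpha>. \<forall>j\<in>S. initial j (hd ws)} =
    card (trace_lists (Suc q) (\<alpha> - mset_set S))"
  using assms
proof (induction S arbitrary: \<alpha>)
  case (insert i S)
  have Di: "D i j" and ij: "i \<noteq> j" and j: "j \<in># \<alpha>" if "j \<in> S" for j
    using insert.prems insert.hyps that by (auto simp: cliques_def pairwise_def)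
  have "i \<in># \<alpha>" using insert.prems by (auto simp: cliques_def)
  have "S \<in> cliques (\<alpha> - {#i#})"
    using insert.prems ij j unfolding cliques_def
    by (auto simp: pairwise_insert in_diff_count count_single simp flip: count_greater_zero_iff)
  then show ?case
    using insert.IH[of "\<alpha> - {#i#}"] insert.hyps card_trace_lists_initial_insert[OF \<open>i \<in># \<alpha>\<close> Di]
    by simp
qed simp

text \<open>The inversion formula of Cartier and Foata: a list of traces is counted once for each set of
  initial letters of its first trace, with alternating signs, so that only an empty first trace
  survives.\<close>

lemma sum_cliques_card_trace_lists:
  "(\<Sum>S\<in>cliques \<alpha>. (- 1) ^ card S * of_nat (card (trace_lists (Suc q) (\<alpha> - mset_set S)))) =
    (of_nat (card (trace_lists q \<alpha>)) :: 'a::comm_ring_1)"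
proof -
  let ?X = "trace_lists (Suc q) \<alpha>"
  have "(\<Sum>S\<in>cliques \<alpha>. (- 1) ^ card S * of_nat (card (trace_lists (Suc q) (\<alpha> - mset_set S)))) =
    (\<Sum>S\<in>cliques \<alpha>. \<Sum>ws\<in>?X. if \<forall>j\<in>S. initial j (hd ws) then (- 1 :: 'a) ^ card S else 0)"
  proof (rule sum.cong)
    fix S assume "S \<in> cliques \<alpha>"
    then show "(- 1 :: 'a) ^ card S * of_nat (card (trace_lists (Suc q) (\<alpha> - mset_set S))) =
        (\<Sum>ws\<in>?X. if \<forall>j\<in>S. initial j (hd ws) then (- 1) ^ card S else 0)"
      using finite_clique by (simp flip: card_trace_lists_initial sum.inter_filter add: mult.commute)
  qed simp
  also have "\<dots> = (\<Sum>ws\<in>?X. \<Sum>S\<in>cliques \<alpha>. if \<forall>j\<in>S. initial j (hd ws) then (- 1) ^ card S else 0)"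
    by (rule sum.swap)
  also have "\<dots> = (\<Sum>ws\<in>?X. if hd ws = [] then 1 else 0)"
  proof (rule sum.cong)
    fix ws assume ws: "ws \<in> ?X"
    let ?F = "{j. initial j (hd ws)}"
    have "hd ws \<in> set ws" using ws by (cases ws) (auto simp: trace_lists_def)
    then have "mset (hd ws) \<subseteq># \<alpha>"
      using ws mset_subseteq_sum_list[of _ ws mset] by (auto simp: trace_lists_def)
    then have F: "?F \<subseteq> set_mset \<alpha>"
      using initial_in_set set_mset_mono by fastforce
    then have fin: "finite ?F" by (rule finite_subset) simp
    \<comment> \<open>By \<open>initial_commute\<close> every set of initial letters is a clique, so
      the contributing cliques form a full power set, whose alternating sum vanishes unless the
      first trace is empty.\<close>
    have "{S \<in> cliques \<alpha>. \<forall>j\<in>S. initial j (hd ws)} = Pow ?F"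
      using F by (auto simp: cliques_def pairwise_def intro: initial_commute)
    then show "(\<Sum>S\<in>cliques \<alpha>. if \<forall>j\<in>S. initial j (hd ws) then (- 1) ^ card S else 0) =
        (if hd ws = [] then 1 else 0 :: 'a)"
      using sum_minus_one_power_card_Pow[OF fin, where 'a = 'a] initial_all_empty[of "hd ws"]
      by (simp flip: sum.inter_filter)
  qed simp
  also have "\<dots> = of_nat (card {ws \<in> ?X. hd ws = []})"
    by (simp flip: sum.inter_filter)
  also have "{ws \<in> ?X. hd ws = []} = Cons [] ` trace_lists q \<alpha>"
    by (auto simp: trace_lists_def length_Suc_conv image_iff)
  also have "card \<dots> = card (trace_lists q \<alpha>)"
    by (rule card_image) simp
  finally show ?thesis .
qed

section \<open>Tuples of cliques and generalized binomial coefficients\<close>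

definition clique_tuples :: "nat \<Rightarrow> 'i multiset \<Rightarrow> 'i set list set" where
  "clique_tuples m \<alpha> = {Ss. length Ss = m \<and> (\<forall>S\<in>set Ss. S \<noteq> {} \<and> finite S \<and> pairwise D S) \<and>
     (\<Sum>S\<leftarrow>Ss. mset_set S) = \<alpha>}"

lemma clique_tuples_0: "clique_tuples 0 \<alpha> = (if \<alpha> = {#} then {[]} else {})"
  by (auto simp: clique_tuples_def)

lemma clique_tuples_Suc:
  "clique_tuples (Suc m) \<alpha> =
    (\<lambda>(S, Ss). S # Ss) ` (SIGMA S : cliques \<alpha> - {{}}. clique_tuples m (\<alpha> - mset_set S))"
    (is "?L = ?R")
proof
  show "?L \<subseteq> ?R"
  proof
    fix Ts assume "Ts \<in> ?L"
    then obtain S Ss where "Ts = S # Ss" "length Ss = m" "S \<noteq> {}" "finite S" "pairwise D S"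
      "\<forall>S\<in>set Ss. S \<noteq> {} \<and> finite S \<and> pairwise D S" "\<alpha> = mset_set S + (\<Sum>S\<leftarrow>Ss. mset_set S)"
      by (cases Ts) (auto simp: clique_tuples_def)
    then show "Ts \<in> ?R"
      by (auto simp: clique_tuples_def cliques_def image_iff)
  qed
  show "?R \<subseteq> ?L"
    using finite_clique mset_set_clique
    by (auto simp: clique_tuples_def) (auto simp: cliques_def)
qed

lemma finite_clique_tuples [simp]: "finite (clique_tuples m \<alpha>)"
  by (induction m arbitrary: \<alpha>) (auto simp: clique_tuples_0 clique_tuples_Suc)

lemma card_clique_tuples_Suc:
  "card (clique_tuples (Suc m) \<alpha>) = (\<Sum>S\<in>cliques \<alpha> - {{}}. card (clique_tuples m (\<alpha> - mset_set S)))"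
  unfolding clique_tuples_Suc
  by (subst card_image) (auto simp: inj_on_def intro: card_SigmaI)

lemma clique_tuples_empty: "size \<alpha> < m \<Longrightarrow> clique_tuples m \<alpha> = {}"
proof -
  have "length Ss \<le> size (\<Sum>S\<leftarrow>Ss. mset_set S)" if "\<forall>S\<in>set Ss. S \<noteq> {} \<and> finite S" for Ss :: "'i set list"
    using that by (induction Ss) (auto simp: Suc_le_eq card_gt_0_iff add_strict_increasing add_less_le_mono
        intro: less_le_trans)
  then show "size \<alpha> < m \<Longrightarrow> clique_tuples m \<alpha> = {}"
    by (fastforce simp: clique_tuples_def)
qed

text \<open>A free argument \<open>x\<close> stands in place of -q because the recursion relates the
  values at \<open>x\<close> and \<open>x + 1\<close>. The built-in sign absorbs the factors
  \<open>(- 1) ^ card S\<close>.\<close>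

definition signed_chromatic :: "'a::field_char_0 \<Rightarrow> 'i multiset \<Rightarrow> 'a" where
  "signed_chromatic x \<alpha> =
     (- 1) ^ size \<alpha> * (\<Sum>m\<le>size \<alpha>. of_nat (card (clique_tuples m \<alpha>)) * (x gchoose m))"

text \<open>The multisets \<open>\<alpha> - mset_set S\<close> have different sizes; a common range
  for \<open>m\<close> allows the sums over \<open>S\<close> and \<open>m\<close> to be
  exchanged.\<close>

lemma signed_chromatic_bound:
  assumes "size \<alpha> \<le> n"
  shows "signed_chromatic x \<alpha> =
     (- 1) ^ size \<alpha> * (\<Sum>m\<le>n. of_nat (card (clique_tuples m \<alpha>)) * (x gchoose m))"
  unfolding signed_chromatic_def using assms
  by (intro arg_cong2[of _ _ _ _ "(*)"] sum.mono_neutral_left) (auto simp: clique_tuples_empty)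

text \<open>Pascal's rule turns the recursion of the clique tuples into that of the traces.\<close>

lemma sum_cliques_signed_chromatic:
  "(\<Sum>S\<in>cliques \<alpha>. (- 1) ^ card S * signed_chromatic x (\<alpha> - mset_set S)) = signed_chromatic (x + 1) \<alpha>"
proof -
  let ?n = "size \<alpha>" and ?c = "\<lambda>m \<beta>. of_nat (card (clique_tuples m \<beta>)) :: 'a"
  have "(\<Sum>S\<in>cliques \<alpha>. (- 1) ^ card S * signed_chromatic x (\<alpha> - mset_set S)) =
    (\<Sum>S\<in>cliques \<alpha>. (- 1) ^ ?n * (\<Sum>m\<le>?n. ?c m (\<alpha> - mset_set S) * (x gchoose m)))"
  proof (rule sum.cong)
    fix S assume S: "S \<in> cliques \<alpha>"
    have "?n = card S + size (\<alpha> - mset_set S)"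
      using mset_set_clique[OF S] by (metis size_mset_set size_union subset_mset.add_diff_inverse)
    then show "(- 1) ^ card S * signed_chromatic x (\<alpha> - mset_set S) =
        (- 1) ^ ?n * (\<Sum>m\<le>?n. ?c m (\<alpha> - mset_set S) * (x gchoose m))"
      by (subst signed_chromatic_bound[of _ ?n]) (auto simp: power_add)
  qed simp
  also have "\<dots> = (- 1) ^ ?n * (\<Sum>m\<le>?n. (\<Sum>S\<in>cliques \<alpha>. ?c m (\<alpha> - mset_set S)) * (x gchoose m))"
    by (simp add: sum_distrib_left sum_distrib_right sum.swap[of _ _ "cliques \<alpha>"])
  \<comment> \<open>The empty clique gives the tuples of length \<open>m\<close> for
    \<open>\<alpha>\<close> itself; a non-empty \<open>S\<close> is the head of a tuple of length
    \<open>Suc m\<close>.\<close>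
  also have "(\<Sum>m\<le>?n. (\<Sum>S\<in>cliques \<alpha>. ?c m (\<alpha> - mset_set S)) * (x gchoose m)) =
    (\<Sum>m\<le>?n. (?c m \<alpha> + ?c (Suc m) \<alpha>) * (x gchoose m))"
    by (simp add: card_clique_tuples_Suc sum.remove[of "cliques \<alpha>" "{}"])
  also have "\<dots> = (\<Sum>m\<le>?n. ?c m \<alpha> * (x gchoose m)) + (\<Sum>m\<le>?n. ?c (Suc m) \<alpha> * (x gchoose m))"
    by (simp add: distrib_right sum.distrib)
  \<comment> \<open>The new top term is zero, since no tuple is longer than
    \<open>size \<alpha>\<close>; it aligns this sum with the shifted one.\<close>
  also have "(\<Sum>m\<le>?n. ?c m \<alpha> * (x gchoose m)) = (\<Sum>m\<le>Suc ?n. ?c m \<alpha> * (x gchoose m))"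
    by (simp add: clique_tuples_empty)
  also have "\<dots> = ?c 0 \<alpha> + (\<Sum>m\<le>?n. ?c (Suc m) \<alpha> * (x gchoose Suc m))"
    by (subst sum.atMost_Suc_shift) simp
  also have "\<dots> + (\<Sum>m\<le>?n. ?c (Suc m) \<alpha> * (x gchoose m)) =
      ?c 0 \<alpha> + (\<Sum>m\<le>?n. ?c (Suc m) \<alpha> * ((x + 1) gchoose Suc m))"
    unfolding gbinomial_Suc_Suc by (simp add: distrib_left sum.distrib add_ac)
  also have "\<dots> = (\<Sum>m\<le>Suc ?n. ?c m \<alpha> * ((x + 1) gchoose m))"
    by (subst sum.atMost_Suc_shift) simp
  finally show ?thesis
    by (simp add: signed_chromatic_bound[of \<alpha> "Suc ?n"])
qed

text \<open>Division by 1 + z in disguise. The signed clique sums of both sides agree by induction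
  on \<open>q\<close>, as - (q + 1) + 1 = - q; their terms with \<open>S \<noteq> {}\<close> agree
  by induction on the size of \<open>\<alpha>\<close>; so the terms with \<open>S = {}\<close> agree
  as well.\<close>

theorem card_trace_lists:
  "of_nat (card (trace_lists q \<alpha>)) = (signed_chromatic (- of_nat q) \<alpha> :: 'a::field_char_0)"
proof (induction q arbitrary: \<alpha>)
  case 0
  show ?case
    by (auto simp: signed_chromatic_def trace_lists_0 clique_tuples_0 gbinomial_0_left if_distrib
        intro!: sum.neutral cong: if_cong)
next
  case (Suc q)
  show ?case
  proof (induction \<alpha> rule: measure_induct_rule[where f = size])
    case (less \<alpha>)
    let ?N = "\<lambda>\<alpha>. of_nat (card (trace_lists (Suc q) \<alpha>)) :: 'a"
      and ?r = "\<lambda>\<alpha>. signed_chromatic (- of_nat (Suc q)) \<alpha> :: 'a"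
    have "?N (\<alpha> - mset_set S) = ?r (\<alpha> - mset_set S)" if S: "S \<in> cliques \<alpha> - {{}}" for S
    proof (rule less.IH)
      have "mset_set S \<noteq> {#}" "mset_set S \<subseteq># \<alpha>"
        using S finite_clique mset_set_clique by (auto simp: mset_set_empty_iff)
      then show "size (\<alpha> - mset_set S) < size \<alpha>"
        by (metis diff_less nonempty_has_size order_less_le_trans size_Diff_submset size_mset_mono)
    qed
    moreover have "(\<Sum>S\<in>cliques \<alpha>. (- 1) ^ card S * ?N (\<alpha> - mset_set S)) =
        (\<Sum>S\<in>cliques \<alpha>. (- 1) ^ card S * ?r (\<alpha> - mset_set S))"
      using Suc.IH[of \<alpha>] by (simp add: sum_cliques_card_trace_lists sum_cliques_signed_chromatic)
    ultimately show ?case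
      by (simp add: sum.remove[of "cliques \<alpha>" "{}"])
  qed
qed

end


section \<open>Linear spans in presented algebras\<close>

text \<open>An inductive form of the span, so that claims about products and tensor slots become
  rule inductions; \<open>linear_span_subset_submodule\<close> leads back to
  \<open>span\<close>.\<close>

inductive_set linear_span :: "(complex, 'a) module \<Rightarrow> 'a set \<Rightarrow> 'a set" for M B where
  base: "x \<in> B \<Longrightarrow> x \<in> linear_span M B"
| zero: "\<zero>\<^bsub>M\<^esub> \<in> linear_span M B"
| add: "x \<in> linear_span M B \<Longrightarrow> y \<in> linear_span M B \<Longrightarrow> x \<oplus>\<^bsub>M\<^esub> y \<in> linear_span M B"
| smult: "x \<in> linear_span M B \<Longrightarrow> c \<odot>\<^bsub>M\<^esub> x \<in> linear_span M B"

lemma linear_span_mono: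
  assumes "B \<subseteq> C"
  shows "linear_span M B \<subseteq> linear_span M C"
proof
  fix x assume "x \<in> linear_span M B"
  then show "x \<in> linear_span M C"
    by induction (use assms in \<open>auto intro: linear_span.intros\<close>)
qed

lemma linear_span_subset_submodule:
  assumes "submodule class_ring N M" "B \<subseteq> N"
  shows "linear_span M B \<subseteq> N"
proof
  interpret submodule class_ring N M by fact
  fix x assume "x \<in> linear_span M B"
  then show "x \<in> N"
    by induction (use assms(2) m_closed zero_closed smult_closed in auto)
qed

lemma term_cong_closed: "term_cong T E s t \<Longrightarrow> s \<in> T \<and> t \<in> T"
  by (induction rule: term_cong.induct) auto

lemma term_class_eq_iff: "t \<in> T \<Longrightarrow> term_class T E s = term_class T E t \<longleftrightarrow> term_cong T E s t"
  unfolding term_class_def by (auto intro: term_cong.intros)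

text \<open>Maps out of a quotient will be evaluated at the \<open>SOME\<close> representative.
  Reflexivity makes the class inhabited, so the chosen term is congruent to any given one.\<close>

lemma term_class_some:
  assumes "x \<in> term_class T E ` T"
  shows "(SOME t. t \<in> x) \<in> T" "term_class T E (SOME t. t \<in> x) = x"
proof -
  obtain t where t: "t \<in> T" "x = term_class T E t" using assms by auto
  then have "t \<in> x" by (auto simp: term_class_def intro: term_cong.refl)
  then have "(SOME t. t \<in> x) \<in> x" by (rule someI)
  then have some: "term_cong T E t (SOME t. t \<in> x)" using t by (simp add: term_class_def)
  show "(SOME t. t \<in> x) \<in> T" using term_cong_closed[OF some] by simp
  show "term_class T E (SOME t. t \<in> x) = x"
    using term_cong.sym[OF some] t by (simp add: term_class_eq_iff)
qed

lemma term_cong_some: "t \<in> T \<Longrightarrow> term_cong T E (SOME s. s \<in> term_class T E t) t"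
  by (metis imageI term_class_some(2) term_class_eq_iff)

section \<open>Presented vector spaces, from linear, Lie or associative terms alike\<close>

locale presentation =
  fixes T :: "'x alg_term set" and E :: "('x alg_term \<times> 'x alg_term) set"
  assumes Zero_closed [simp, intro]: "Zero \<in> T"
    and Add_closed [simp, intro]: "s \<in> T \<Longrightarrow> t \<in> T \<Longrightarrow> Add s t \<in> T"
    and Smult_closed [simp, intro]: "t \<in> T \<Longrightarrow> Smult c t \<in> T"
    and vector_space_ids: "vector_space_ids \<subseteq> E"
begin

lemma carrier_presented: "carrier (presented_algebra T E) = term_class T E ` T"
  and zero_presented: "\<zero>\<^bsub>presented_algebra T E\<^esub> = term_class T E Zero"
  and one_presented: "\<one>\<^bsub>presented_algebra T E\<^esub> = term_class T E One"
  by (simp_all add: presented_algebra_def)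

text \<open>The operation on classes collects the results over all representatives; by congruence
  every pair yields the same class. Closure of \<open>T\<close> supplies the membership conditions
  of \<open>term_cong.add\<close>.\<close>

lemma add_presented:
  assumes "s \<in> T" "t \<in> T"
  shows "term_class T E s \<oplus>\<^bsub>presented_algebra T E\<^esub> term_class T E t = term_class T E (Add s t)"
proof -
  have "term_cong T E (Add s t) (Add s' t')" if "term_cong T E s s'" "term_cong T E t t'" for s' t'
    using term_cong_closed[OF that(1)] term_cong_closed[OF that(2)]
    by (intro term_cong.add[OF that] Add_closed) auto
  then have "(\<exists>s'. term_cong T E s s' \<and> (\<exists>t'. term_cong T E t t' \<and> term_cong T E (Add s' t') u)) \<longleftrightarrow>
      term_cong T E (Add s t) u" for u
    using assms by (blast intro: term_cong.trans term_cong.refl)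
  then show ?thesis
    by (simp add: presented_algebra_def term_class_def Bex_def)
qed

lemma smult_presented:
  assumes "t \<in> T"
  shows "c \<odot>\<^bsub>presented_algebra T E\<^esub> term_class T E t = term_class T E (Smult c t)"
proof -
  have "term_cong T E (Smult c t) (Smult c t')" if "term_cong T E t t'" for t'
    using term_cong_closed[OF that] by (intro term_cong.smult[OF that]) auto
  then have "(\<exists>t'. term_cong T E t t' \<and> term_cong T E (Smult c t') u) \<longleftrightarrow> term_cong T E (Smult c t) u" for u
    using assms by (blast intro: term_cong.trans term_cong.refl)
  then show ?thesis
    by (simp add: presented_algebra_def term_class_def Bex_def)
qed

lemma mult_presented:
  assumes "\<And>s t. s \<in> T \<Longrightarrow> t \<in> T \<Longrightarrow> Mult s t \<in> T" "s \<in> T" "t \<in> T"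
  shows "term_class T E s \<otimes>\<^bsub>presented_algebra T E\<^esub> term_class T E t = term_class T E (Mult s t)"
proof -
  have "term_cong T E (Mult s t) (Mult s' t')" if "term_cong T E s s'" "term_cong T E t t'" for s' t'
    using term_cong_closed[OF that(1)] term_cong_closed[OF that(2)]
    by (intro term_cong.mult[OF that] assms(1)) auto
  then have "(\<exists>s'. term_cong T E s s' \<and> (\<exists>t'. term_cong T E t t' \<and> term_cong T E (Mult s' t') u)) \<longleftrightarrow>
      term_cong T E (Mult s t) u" for u
    using assms(2,3) by (blast intro: term_cong.trans term_cong.refl)
  then show ?thesis
    by (simp add: presented_algebra_def term_class_def Bex_def)
qed

lemma term_class_ident: "(s, t) \<in> E \<Longrightarrow> s \<in> T \<Longrightarrow> t \<in> T \<Longrightarrow> term_class T E s = term_class T E t"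
  by (simp add: term_class_eq_iff term_cong.ident)

lemma vector_space_ident:
  "(s, t) \<in> vector_space_ids \<Longrightarrow> s \<in> T \<Longrightarrow> t \<in> T \<Longrightarrow> term_class T E s = term_class T E t"
  using vector_space_ids by (intro term_class_ident) auto

lemma vectorspace_presented: "vectorspace class_ring (presented_algebra T E)"
proof -
  note simps = carrier_presented zero_presented add_presented smult_presented
  note ids = vector_space_ident[OF vector_space_ids.intros(1)]
    vector_space_ident[OF vector_space_ids.intros(3)] vector_space_ident[OF vector_space_ids.intros(4)]
    vector_space_ident[OF vector_space_ids.intros(5)] vector_space_ident[OF vector_space_ids.intros(6)]
    vector_space_ident[OF vector_space_ids.intros(7)] vector_space_ident[OF vector_space_ids.intros(8)]
  have comm: "term_class T E (Add s t) = term_class T E (Add t s)" if "s \<in> T" "t \<in> T" for s t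
    using that by (intro vector_space_ident vector_space_ids.intros) auto
  \<comment> \<open>Additive inverses are not among the identities; they come from t + (-1)t = 1t +
    (-1)t = 0t = 0.\<close>
  have neg: "term_class T E (Add t (Smult (- 1) t)) = term_class T E Zero" if "t \<in> T" for t
  proof -
    have "term_class T E (Add t (Smult (- 1) t)) = term_class T E t \<oplus>\<^bsub>presented_algebra T E\<^esub> term_class T E (Smult (- 1) t)"
      using that by (simp add: simps)
    also have "\<dots> = term_class T E (Smult 1 t) \<oplus>\<^bsub>presented_algebra T E\<^esub> term_class T E (Smult (- 1) t)"
      using that by (simp add: ids)
    also have "\<dots> = term_class T E (Smult (1 + - 1) t)"
      using that by (simp only: simps ids(6) Smult_closed Add_closed)
    also have "\<dots> = term_class T E Zero"
      using that by (simp add: ids)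
    finally show ?thesis .
  qed
  show ?thesis
  proof (rule vs_criteria)
    show "field (class_ring :: complex ring)" by (rule class_field)
    show "\<forall>v\<in>carrier (presented_algebra T E). \<exists>n\<in>carrier (presented_algebra T E).
        v \<oplus>\<^bsub>presented_algebra T E\<^esub> n = \<zero>\<^bsub>presented_algebra T E\<^esub>"
      using neg by (fastforce simp: simps)
    show "\<forall>v w. v \<in> carrier (presented_algebra T E) \<and> w \<in> carrier (presented_algebra T E) \<longrightarrow>
        v \<oplus>\<^bsub>presented_algebra T E\<^esub> w = w \<oplus>\<^bsub>presented_algebra T E\<^esub> v"
      using comm by (auto simp: simps)
    show "\<forall>v\<in>carrier (presented_algebra T E). v \<oplus>\<^bsub>presented_algebra T E\<^esub> \<zero>\<^bsub>presented_algebra T E\<^esub> = v"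
      using comm[OF _ Zero_closed] by (auto simp: simps ids)
  qed (auto simp: simps ids)
qed

lemma linear_span_carrier:
  "B \<subseteq> carrier (presented_algebra T E) \<Longrightarrow>
    linear_span (presented_algebra T E) B \<subseteq> carrier (presented_algebra T E)"
proof -
  interpret vectorspace class_ring "presented_algebra T E" by (rule vectorspace_presented)
  have "submodule class_ring (carrier (presented_algebra T E)) (presented_algebra T E)"
    by unfold_locales auto
  then show "B \<subseteq> carrier (presented_algebra T E) \<Longrightarrow> ?thesis"
    by (rule linear_span_subset_submodule)
qed

lemma zero_smult_presented:
  "x \<in> carrier (presented_algebra T E) \<Longrightarrow> 0 \<odot>\<^bsub>presented_algebra T E\<^esub> x = \<zero>\<^bsub>presented_algebra T E\<^esub>"
  using vector_space_ident[OF vector_space_ids.intros(4)]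
  by (auto simp: carrier_presented zero_presented smult_presented)

end

sublocale presentation \<subseteq> V: vectorspace class_ring "presented_algebra T E"
  by (rule vectorspace_presented)

section \<open>Unital associative presentations and spans of products\<close>

locale assoc_presentation = presentation +
  assumes One_closed [simp, intro]: "One \<in> T"
    and Mult_closed [simp, intro]: "s \<in> T \<Longrightarrow> t \<in> T \<Longrightarrow> Mult s t \<in> T"
    and bilinear_ids: "bilinear_ids \<subseteq> E"
    and assoc_ids: "assoc_ids \<subseteq> E"
begin

abbreviation "P \<equiv> presented_algebra T E"

lemmas carrier_P = carrier_presented
lemmas mult_P = mult_presented[OF Mult_closed]
lemmas P_simps = carrier_P zero_presented one_presented add_presented smult_presented mult_P

lemma bilinear_ident:
  "(s, t) \<in> bilinear_ids \<Longrightarrow> s \<in> T \<Longrightarrow> t \<in> T \<Longrightarrow> term_class T E s = term_class T E t"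
  using bilinear_ids by (intro term_class_ident) auto

lemma assoc_ident:
  "(s, t) \<in> assoc_ids \<Longrightarrow> s \<in> T \<Longrightarrow> t \<in> T \<Longrightarrow> term_class T E s = term_class T E t"
  using assoc_ids by (intro term_class_ident) auto

lemma P_closed [simp]:
  "\<zero>\<^bsub>P\<^esub> \<in> carrier P" "\<one>\<^bsub>P\<^esub> \<in> carrier P"
  "x \<in> carrier P \<Longrightarrow> y \<in> carrier P \<Longrightarrow> x \<oplus>\<^bsub>P\<^esub> y \<in> carrier P"
  "x \<in> carrier P \<Longrightarrow> c \<odot>\<^bsub>P\<^esub> x \<in> carrier P"
  "x \<in> carrier P \<Longrightarrow> y \<in> carrier P \<Longrightarrow> x \<otimes>\<^bsub>P\<^esub> y \<in> carrier P"
  by (auto simp: P_simps)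

lemma P_bilinear:
  assumes "x \<in> carrier P" "y \<in> carrier P" "z \<in> carrier P"
  shows "(x \<oplus>\<^bsub>P\<^esub> y) \<otimes>\<^bsub>P\<^esub> z = x \<otimes>\<^bsub>P\<^esub> z \<oplus>\<^bsub>P\<^esub> y \<otimes>\<^bsub>P\<^esub> z"
    and "x \<otimes>\<^bsub>P\<^esub> (y \<oplus>\<^bsub>P\<^esub> z) = x \<otimes>\<^bsub>P\<^esub> y \<oplus>\<^bsub>P\<^esub> x \<otimes>\<^bsub>P\<^esub> z"
    and "(c \<odot>\<^bsub>P\<^esub> x) \<otimes>\<^bsub>P\<^esub> y = c \<odot>\<^bsub>P\<^esub> (x \<otimes>\<^bsub>P\<^esub> y)"
    and "x \<otimes>\<^bsub>P\<^esub> (c \<odot>\<^bsub>P\<^esub> y) = c \<odot>\<^bsub>P\<^esub> (x \<otimes>\<^bsub>P\<^esub> y)"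
proof -
  obtain r s t where "r \<in> T" "s \<in> T" "t \<in> T" "x = term_class T E r" "y = term_class T E s"
    "z = term_class T E t"
    using assms by (auto simp: carrier_P)
  then show "(x \<oplus>\<^bsub>P\<^esub> y) \<otimes>\<^bsub>P\<^esub> z = x \<otimes>\<^bsub>P\<^esub> z \<oplus>\<^bsub>P\<^esub> y \<otimes>\<^bsub>P\<^esub> z"
    and "x \<otimes>\<^bsub>P\<^esub> (y \<oplus>\<^bsub>P\<^esub> z) = x \<otimes>\<^bsub>P\<^esub> y \<oplus>\<^bsub>P\<^esub> x \<otimes>\<^bsub>P\<^esub> z"
    and "(c \<odot>\<^bsub>P\<^esub> x) \<otimes>\<^bsub>P\<^esub> y = c \<odot>\<^bsub>P\<^esub> (x \<otimes>\<^bsub>P\<^esub> y)"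
    and "x \<otimes>\<^bsub>P\<^esub> (c \<odot>\<^bsub>P\<^esub> y) = c \<odot>\<^bsub>P\<^esub> (x \<otimes>\<^bsub>P\<^esub> y)"
    by (simp_all add: P_simps bilinear_ident[OF bilinear_ids.intros(1)]
        bilinear_ident[OF bilinear_ids.intros(2)] bilinear_ident[OF bilinear_ids.intros(3)]
        bilinear_ident[OF bilinear_ids.intros(4)])
qed

lemma P_assoc:
  assumes "x \<in> carrier P" "y \<in> carrier P" "z \<in> carrier P"
  shows "(x \<otimes>\<^bsub>P\<^esub> y) \<otimes>\<^bsub>P\<^esub> z = x \<otimes>\<^bsub>P\<^esub> (y \<otimes>\<^bsub>P\<^esub> z)"
proof -
  obtain r s t where "r \<in> T" "s \<in> T" "t \<in> T" "x = term_class T E r" "y = term_class T E s"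
    "z = term_class T E t"
    using assms by (auto simp: carrier_P)
  then show ?thesis
    by (simp add: P_simps assoc_ident[OF assoc_ids.intros(1)])
qed

lemma P_one [simp]:
  assumes "x \<in> carrier P"
  shows "\<one>\<^bsub>P\<^esub> \<otimes>\<^bsub>P\<^esub> x = x" and "x \<otimes>\<^bsub>P\<^esub> \<one>\<^bsub>P\<^esub> = x"
proof -
  obtain t where "t \<in> T" "x = term_class T E t"
    using assms by (auto simp: carrier_P)
  then show "\<one>\<^bsub>P\<^esub> \<otimes>\<^bsub>P\<^esub> x = x" and "x \<otimes>\<^bsub>P\<^esub> \<one>\<^bsub>P\<^esub> = x"
    by (simp_all add: P_simps assoc_ident[OF assoc_ids.intros(2)] assoc_ident[OF assoc_ids.intros(3)])
qed

lemma linear_span_mult: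
  assumes x: "x \<in> linear_span P B" and y: "y \<in> linear_span P C"
    and B: "B \<subseteq> carrier P" and C: "C \<subseteq> carrier P"
  shows "x \<otimes>\<^bsub>P\<^esub> y \<in> linear_span P {b \<otimes>\<^bsub>P\<^esub> c | b c. b \<in> B \<and> c \<in> C}" (is "_ \<in> ?S")
proof -
  have spanB: "linear_span P B \<subseteq> carrier P" and spanC: "linear_span P C \<subseteq> carrier P"
    using B C linear_span_carrier by auto
  \<comment> \<open>Zero is written as a scalar multiple by 0, and the scalar is pulled out of the
    product.\<close>
  have zero_mult: "\<zero>\<^bsub>P\<^esub> \<otimes>\<^bsub>P\<^esub> z = \<zero>\<^bsub>P\<^esub>" "z \<otimes>\<^bsub>P\<^esub> \<zero>\<^bsub>P\<^esub> = \<zero>\<^bsub>P\<^esub>" if "z \<in> carrier P" for z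
    using that P_bilinear(3)[of z z z 0] P_bilinear(4)[of z z z 0] by (simp_all add: zero_smult_presented)
  have "b \<otimes>\<^bsub>P\<^esub> y \<in> ?S" if b: "b \<in> B" for b
    using y
  proof induction
    case (base c)
    then show ?case using b by (intro linear_span.base) auto
  next
    case zero
    show ?case using subsetD[OF B b] by (simp add: zero_mult linear_span.zero)
  next
    case (add c d)
    moreover have "b \<otimes>\<^bsub>P\<^esub> (c \<oplus>\<^bsub>P\<^esub> d) = b \<otimes>\<^bsub>P\<^esub> c \<oplus>\<^bsub>P\<^esub> b \<otimes>\<^bsub>P\<^esub> d"
      using add.hyps b B spanC by (intro P_bilinear) auto
    ultimately show ?case by (simp add: linear_span.add)
  next
    case (smult d c)
    moreover have "b \<otimes>\<^bsub>P\<^esub> (c \<odot>\<^bsub>P\<^esub> d) = c \<odot>\<^bsub>P\<^esub> (b \<otimes>\<^bsub>P\<^esub> d)"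
      using smult.hyps b B spanC by (intro P_bilinear[of _ _ b]) auto
    ultimately show ?case by (simp add: linear_span.smult)
  qed
  note base = this
  have ycar: "y \<in> carrier P" using y spanC by auto
  show ?thesis
    using x
  proof induction
    case zero
    show ?case using ycar by (simp add: zero_mult linear_span.zero)
  next
    case (add c d)
    moreover have "(c \<oplus>\<^bsub>P\<^esub> d) \<otimes>\<^bsub>P\<^esub> y = c \<otimes>\<^bsub>P\<^esub> y \<oplus>\<^bsub>P\<^esub> d \<otimes>\<^bsub>P\<^esub> y"
      using add.hyps ycar spanB by (intro P_bilinear) auto
    ultimately show ?case by (simp add: linear_span.add)
  next
    case (smult d c)
    moreover have "(c \<odot>\<^bsub>P\<^esub> d) \<otimes>\<^bsub>P\<^esub> y = c \<odot>\<^bsub>P\<^esub> (d \<otimes>\<^bsub>P\<^esub> y)"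
      using smult.hyps ycar spanB by (intro P_bilinear[of _ _ y]) auto
    ultimately show ?case by (simp add: linear_span.smult)
  qed (rule base)
qed

end


section \<open>The Verma module\<close>

text \<open>Instead of the module itself, spanned by the traces, its dual is used: a linear form on it is a
  function of words that is invariant under swaps of commuting letters. The operators below are the
  transposes of the actions of the generators, hence the reversed order of composition
  for \<open>Mult\<close>.\<close>

context
  fixes A :: "'i \<Rightarrow> 'i \<Rightarrow> real"
begin

text \<open>The eigenvalue of h_i on the vector obtained by applying the word \<open>w\<close> to
  the lowest weight vector, whose own weight is 0.\<close>

definition weight :: "'i \<Rightarrow> 'i list \<Rightarrow> complex" where
  "weight i w = (\<Sum>j\<leftarrow>w. complex_of_real (A i j))"

text \<open>The value of \<open>F\<close> at f_i w. From [e_j, f_i] = \<delta>_ij h_i comes f_i (j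
  w) = j (f_i w) - \<delta>_ij h_i w, and f_i kills the lowest weight vector. As f_i w is a
  combination of words, prefixing \<open>j\<close> to all of them amounts to replacing
  \<open>F\<close> by \<open>\<lambda>v. F (j # v)\<close>.\<close>

primrec lowering :: "'i \<Rightarrow> 'i list \<Rightarrow> ('i list \<Rightarrow> complex) \<Rightarrow> complex" where
  "lowering i [] F = 0"
| "lowering i (j # w) F = lowering i w (\<lambda>v. F (j # v)) - (if i = j then weight i w * F w else 0)"

primrec gen_op :: "'i chevalley_gen \<Rightarrow> ('i list \<Rightarrow> complex) \<Rightarrow> 'i list \<Rightarrow> complex" where
  "gen_op (e_gen i) F = (\<lambda>w. F (i # w))"
| "gen_op (f_gen i) F = (\<lambda>w. lowering i w F)"
| "gen_op (h_gen i) F = (\<lambda>w. weight i w * F w)"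

primrec lie_op :: "'i chevalley_gen alg_term \<Rightarrow> ('i list \<Rightarrow> complex) \<Rightarrow> 'i list \<Rightarrow> complex" where
  "lie_op (Gen x) F = gen_op x F"
| "lie_op Zero F = (\<lambda>w. 0)"
| "lie_op One F = F"
| "lie_op (Add s t) F = (\<lambda>w. lie_op s F w + lie_op t F w)"
| "lie_op (Smult c t) F = (\<lambda>w. c * lie_op t F w)"
| "lie_op (Mult s t) F = (\<lambda>w. lie_op t (lie_op s F) w - lie_op s (lie_op t F) w)"

lemma lowering_linear:
  "lowering i w (\<lambda>v. a * F v + b * G v) = a * lowering i w F + b * lowering i w G"
  by (induction w arbitrary: F G) (auto simp: algebra_simps)

lemma lie_op_linear:
  "lie_op t (\<lambda>w. a * F w + b * G w) = (\<lambda>w. a * lie_op t F w + b * lie_op t G w)"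
proof (induction t arbitrary: a b F G)
  case (Gen x)
  show ?case by (cases x) (auto simp: lowering_linear algebra_simps)
qed (auto simp: algebra_simps)

lemma lie_op_add: "lie_op t (\<lambda>w. F w + G w) = (\<lambda>w. lie_op t F w + lie_op t G w)"
  using lie_op_linear[of t 1 F 1 G] by simp

lemma lie_op_diff: "lie_op t (\<lambda>w. F w - G w) = (\<lambda>w. lie_op t F w - lie_op t G w)"
  using lie_op_linear[of t 1 F "- 1" G] by simp

lemma lie_op_scale: "lie_op t (\<lambda>w. c * F w) = (\<lambda>w. c * lie_op t F w)"
  using lie_op_linear[of t c F 0 F] by simp

text \<open>The relation [h_i, f_j] = - a_ij f_j in transposed form.\<close>

lemma lowering_weight_commutator:
  "lowering j w (\<lambda>v. weight i v * F v) - weight i w * lowering j w F = - A i j * lowering j w F"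
proof -
  \<comment> \<open>Passing a letter k adds a_ik to the weight, so the induction has to carry an
    additive constant \<open>c\<close>.\<close>
  have gen: "lowering j w (\<lambda>v. (c + weight i v) * F v) - (c + weight i w) * lowering j w F =
      - A i j * lowering j w F" for c
  proof (induction w arbitrary: c F)
    case (Cons k w)
    have "lowering j w (\<lambda>v. (c + (A i k + weight i v)) * F (k # v)) =
       (c + A i k + weight i w) * lowering j w (\<lambda>v. F (k # v)) - A i j * lowering j w (\<lambda>v. F (k # v))"
      using Cons.IH[of "c + A i k" "\<lambda>v. F (k # v)"] by (simp add: algebra_simps)
    then show ?case by (auto simp: weight_def algebra_simps)
  qed simp
  show ?thesis using gen[of 0] by simp
qed

text \<open>At the letter \<open>k\<close>, an operator that meets its own letter produces a weight
  term. The weight terms of the two sides match because a_ij = a_ji = 0 lets each weight pass the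
  other operator.\<close>

lemma lowering_commute:
  assumes "A i j = 0" "A j i = 0"
  shows "lowering i w (\<lambda>v. lowering j v F) = lowering j w (\<lambda>v. lowering i v F)"
proof (induction w arbitrary: F)
  case (Cons k w)
  have diff: "lowering i w (\<lambda>v. G v - H v) = lowering i w G - lowering i w H" for i w and G H :: "'i list \<Rightarrow> complex"
    using lowering_linear[of i w 1 G "- 1" H] by simp
  have IH: "lowering i w (\<lambda>v. lowering j v (\<lambda>v. F (k # v))) = lowering j w (\<lambda>v. lowering i v (\<lambda>v. F (k # v)))"
    by (rule Cons.IH)
  have wt: "lowering j w (\<lambda>v. weight i v * F v) = weight i w * lowering j w F"
    "lowering i w (\<lambda>v. weight j v * F v) = weight j w * lowering i w F"
    using lowering_weight_commutator[of j w i F] lowering_weight_commutator[of i w j F] assms by auto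
  have zero: "lowering i w (\<lambda>v. 0) = 0" for i w
    using lowering_linear[of i w 0 "\<lambda>_. 0" 0 "\<lambda>_. 0"] by simp
  show ?case
    using IH wt by (cases "i = k"; cases "j = k") (simp_all add: diff)
qed simp

end

section \<open>Descent of the action from words to traces\<close>

locale borcherds =
  fixes I :: "'i set" and A :: "'i \<Rightarrow> 'i \<Rightarrow> real"
  assumes zero_sym: "i \<in> I \<Longrightarrow> j \<in> I \<Longrightarrow> A i j = 0 \<Longrightarrow> A j i = 0"
begin

text \<open>The complement of the graph, so that its cliques are the independent sets. A letter with
  a_ii = 0 is kept unrelated to itself: exchanging equal letters changes nothing, and a commutation
  relation has to be irreflexive.\<close>

definition D :: "'i \<Rightarrow> 'i \<Rightarrow> bool" where
  "D i j \<longleftrightarrow> i \<in> I \<and> j \<in> I \<and> i \<noteq> j \<and> A i j = 0"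

sublocale commutation D
  by unfold_locales (auto simp: D_def zero_sym)

definition invariant :: "('i list \<Rightarrow> complex) \<Rightarrow> bool" where
  "invariant F \<longleftrightarrow> (\<forall>u v. swap u v \<longrightarrow> F u = F v)"

lemma invariantD: "invariant F \<Longrightarrow> D i j \<Longrightarrow> F (u @ i # j # v) = F (u @ j # i # v)"
  by (auto simp: invariant_def swap.intros)

lemma invariant_Cons: "invariant F \<Longrightarrow> invariant (\<lambda>w. F (i # w))"
  by (simp add: invariant_def swap_Cons)

text \<open>If \<open>i\<close> is one of two swapped letters j and k, its weight term is computed
  with the other letter to its right or without it. The discrepancy is a_jk or a_kj, and both vanish
  for commuting letters; so f_i acts on traces and not only on words.\<close>

lemma invariant_lowering:
  assumes "invariant F"
  shows "invariant (\<lambda>w. lowering A i w F)"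
  unfolding invariant_def
proof (intro allI impI)
  fix u v assume "swap u v"
  then show "lowering A i u F = lowering A i v F"
    using assms
  proof (induction arbitrary: F rule: swap.induct)
    case (1 j k u v)
    then show ?case
    proof (induction u arbitrary: F)
      case Nil
      have "F (j # k # w) = F (k # j # w)" for w
        using invariantD[OF Nil(2,1), of "[]"] by simp
      moreover have "j \<noteq> k" "A j k = 0" "A k j = 0"
        using Nil(1) D_sym[OF Nil(1)] by (simp_all add: D_def)
      ultimately show ?case by (auto simp: weight_def)
    next
      case (Cons l u)
      have "lowering A i (u @ j # k # v) (\<lambda>w. F (l # w)) = lowering A i (u @ k # j # v) (\<lambda>w. F (l # w))"
        using Cons.IH[OF Cons.prems(1) invariant_Cons[OF Cons.prems(2)]] .
      moreover have "weight A l (u @ j # k # v) = weight A l (u @ k # j # v)"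
        by (simp add: weight_def)
      ultimately show ?case
        using invariantD[OF Cons.prems(2,1)] by simp
    qed
  qed
qed

lemma invariant_weight: "invariant F \<Longrightarrow> invariant (\<lambda>w. weight A i w * F w)"
  by (auto simp: invariant_def weight_def elim!: swap.cases intro!: arg_cong2[of _ _ _ _ "(*)"])

lemma invariant_lie_op: "invariant F \<Longrightarrow> invariant (lie_op A t F)"
proof (induction t arbitrary: F)
  case (Gen x)
  then show ?case
    by (cases x) (auto simp: invariant_Cons invariant_lowering invariant_weight)
next
  case (Add s t) then show ?case by (auto simp: invariant_def)
next
  case (Smult c t) then show ?case by (auto simp: invariant_def)
next
  case (Mult s t)
  then have "invariant (lie_op A t (lie_op A s F))" "invariant (lie_op A s (lie_op A t F))"
    by blast+
  then show ?case by (simp add: invariant_def)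
qed (auto simp: invariant_def)

text \<open>Invariance of \<open>F\<close> is what yields [e_i, e_j] = 0 for
  \<open>i \<noteq> j\<close>; the relations that involve f_i or h_i are identities between
  operators on functions of words.\<close>

lemma lie_op_borcherds_rels:
  assumes "(s, t) \<in> borcherds_rels I A" "invariant F"
  shows "lie_op A s F = lie_op A t F"
  using assms
proof cases
  case (3 i j)
  have "lowering A j w (\<lambda>v. weight A i v * F v) - weight A i w * lowering A j w F =
      - A i j * lowering A j w F" for w
    by (rule lowering_weight_commutator)
  then show ?thesis using 3 by simp
next
  case (5 i j)
  show ?thesis
  proof (cases "i = j")
    case False
    then have "D j i" using 5 zero_sym[of i j] by (simp add: D_def)
    then show ?thesis using 5 invariantD[OF assms(2), of j i "[]"] by simp
  qed (use 5 in auto)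
next
  case (6 i j)
  have "lowering A i w (\<lambda>v. lowering A j v F) = lowering A j w (\<lambda>v. lowering A i v F)" for w
    using 6 zero_sym[of i j] by (intro lowering_commute) auto
  then show ?thesis using 6 by simp
qed (auto simp: weight_def algebra_simps)

lemma lie_op_borcherds_ids:
  assumes "(s, t) \<in> borcherds_ids I A" "invariant F"
  shows "lie_op A s F = lie_op A t F"
proof -
  consider "(s, t) \<in> vector_space_ids" | "(s, t) \<in> bilinear_ids" | "(s, t) \<in> lie_ids" |
    "(s, t) \<in> borcherds_rels I A"
    using assms(1) by (auto simp: borcherds_ids_def)
  then show ?thesis
  proof cases
    case 1 then show ?thesis by cases (auto simp: algebra_simps)
  next
    case 2 then show ?thesis by cases (auto simp: algebra_simps lie_op_add lie_op_scale)
  next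
    case 3 then show ?thesis by cases (auto simp: algebra_simps lie_op_diff)
  next
    case 4 then show ?thesis by (rule lie_op_borcherds_rels) (rule assms)
  qed
qed

text \<open>In a bracket each factor is applied to the image of \<open>F\<close> under the other
  one. This image is invariant again, so the induction hypotheses, stated for all invariant
  functions, apply to it.\<close>

lemma lie_op_cong:
  "term_cong T (borcherds_ids I A) s t \<Longrightarrow> invariant F \<Longrightarrow> lie_op A s F = lie_op A t F"
proof (induction arbitrary: F rule: term_cong.induct)
  case (mult s s' t t')
  then show ?case by (simp add: invariant_lie_op)
qed (auto simp: lie_op_borcherds_ids)


section \<open>The grading of the enveloping algebra\<close>

abbreviation "\<g> \<equiv> borcherds_algebra I A"
abbreviation "\<n> \<equiv> n_plus I A"
abbreviation "U \<equiv> enveloping_algebra \<n>"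
abbreviation "\<iota> \<equiv> enveloping_map \<n>"
abbreviation "e \<equiv> chevalley_e I A"

sublocale g: presentation "lie_terms (chevalley_gens I)" "borcherds_ids I A"
  by unfold_locales (auto intro: lie_terms.intros simp: borcherds_ids_def)

sublocale U: assoc_presentation "assoc_terms (carrier \<n>)" "enveloping_ids \<n>"
  rewrites "presented_algebra (assoc_terms (carrier \<n>)) (enveloping_ids \<n>) = U"
proof -
  show "assoc_presentation (assoc_terms (carrier \<n>)) (enveloping_ids \<n>)"
    by unfold_locales (auto simp: assoc_terms_def enveloping_ids_def)
qed (simp add: enveloping_algebra_def)

lemma g_eq: "\<g> = presented_algebra (lie_terms (chevalley_gens I)) (borcherds_ids I A)"
  by (simp add: borcherds_algebra_def)

lemma e_term: "i \<in> I \<Longrightarrow> Gen (e_gen i) \<in> lie_terms (chevalley_gens I)"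
  by (auto intro!: lie_terms.intros simp: chevalley_gens_def)

lemma carrier_g: "carrier \<g> = term_class (lie_terms (chevalley_gens I)) (borcherds_ids I A) ` lie_terms (chevalley_gens I)"
  by (simp add: g_eq g.carrier_presented)

lemmas g_simps = g.add_presented[folded g_eq] g.smult_presented[folded g_eq]
  g.mult_presented[OF lie_terms.intros(5), folded g_eq] g.zero_presented[folded g_eq]

lemma n_plus_subset: "carrier \<n> \<subseteq> carrier \<g>"
proof
  fix x assume "x \<in> carrier \<n>"
  then have "x \<in> generated_subalgebra \<g> (e ` I)" by (simp add: n_plus_def)
  then show "x \<in> carrier \<g>"
    by induction (auto simp: carrier_g g_simps chevalley_e_def e_term intro: lie_terms.intros)
qed

lemma n_plus_ops [simp]:
  "\<zero>\<^bsub>\<n>\<^esub> = \<zero>\<^bsub>\<g>\<^esub>" "x \<oplus>\<^bsub>\<n>\<^esub> y = x \<oplus>\<^bsub>\<g>\<^esub> y" "c \<odot>\<^bsub>\<n>\<^esub> x = c \<odot>\<^bsub>\<g>\<^esub> x" "x \<otimes>\<^bsub>\<n>\<^esub> y = x \<otimes>\<^bsub>\<g>\<^esub> y"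
  by (simp_all add: n_plus_def)

lemma n_plus_closed [simp]:
  "\<zero>\<^bsub>\<g>\<^esub> \<in> carrier \<n>"
  "i \<in> I \<Longrightarrow> e i \<in> carrier \<n>"
  "x \<in> carrier \<n> \<Longrightarrow> y \<in> carrier \<n> \<Longrightarrow> x \<oplus>\<^bsub>\<g>\<^esub> y \<in> carrier \<n>"
  "x \<in> carrier \<n> \<Longrightarrow> c \<odot>\<^bsub>\<g>\<^esub> x \<in> carrier \<n>"
  "x \<in> carrier \<n> \<Longrightarrow> y \<in> carrier \<n> \<Longrightarrow> x \<otimes>\<^bsub>\<g>\<^esub> y \<in> carrier \<n>"
  by (auto simp: n_plus_def intro: generated_subalgebra.intros)

lemma Gen_assoc_terms [simp]: "Gen x \<in> assoc_terms (carrier \<n>) \<longleftrightarrow> x \<in> carrier \<n>"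
  by (simp add: assoc_terms_def)

lemma \<iota>_class: "\<iota> x = term_class (assoc_terms (carrier \<n>)) (enveloping_ids \<n>) (Gen x)"
  by (simp add: enveloping_map_def)

lemma \<iota>_closed [simp]: "x \<in> carrier \<n> \<Longrightarrow> \<iota> x \<in> carrier U"
  by (simp add: \<iota>_class U.carrier_P)

lemma enveloping_ident:
  "(s, t) \<in> enveloping_rels \<n> \<Longrightarrow> s \<in> assoc_terms (carrier \<n>) \<Longrightarrow> t \<in> assoc_terms (carrier \<n>) \<Longrightarrow>
    term_class (assoc_terms (carrier \<n>)) (enveloping_ids \<n>) s =
    term_class (assoc_terms (carrier \<n>)) (enveloping_ids \<n>) t"
  by (rule U.term_class_ident) (auto simp: enveloping_ids_def)

lemma \<iota>_hom:
  assumes "x \<in> carrier \<n>" "y \<in> carrier \<n>"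
  shows "\<iota> (x \<oplus>\<^bsub>\<g>\<^esub> y) = \<iota> x \<oplus>\<^bsub>U\<^esub> \<iota> y"
    and "\<iota> (c \<odot>\<^bsub>\<g>\<^esub> x) = c \<odot>\<^bsub>U\<^esub> \<iota> x"
    and "\<iota> (x \<otimes>\<^bsub>\<g>\<^esub> y) = \<iota> x \<otimes>\<^bsub>U\<^esub> \<iota> y \<oplus>\<^bsub>U\<^esub> (- 1) \<odot>\<^bsub>U\<^esub> (\<iota> y \<otimes>\<^bsub>U\<^esub> \<iota> x)"
  using assms enveloping_ident[OF enveloping_rels.intros(1)[of x \<n> y]]
    enveloping_ident[OF enveloping_rels.intros(2)[of x \<n> c]]
    enveloping_ident[OF enveloping_rels.intros(3)[of x \<n> y]]
  by (simp_all add: \<iota>_class U.P_simps)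

lemma zero_smult_g: "x \<in> carrier \<g> \<Longrightarrow> 0 \<odot>\<^bsub>\<g>\<^esub> x = \<zero>\<^bsub>\<g>\<^esub>"
  using g.zero_smult_presented by (simp add: g_eq)

lemma \<iota>_zero: "\<iota> \<zero>\<^bsub>\<g>\<^esub> = \<zero>\<^bsub>U\<^esub>"
  using \<iota>_hom(2)[OF n_plus_closed(1,1), of 0] zero_smult_g[OF subsetD[OF n_plus_subset n_plus_closed(1)]]
  by (simp add: U.zero_smult_presented)

lemma e_commute:
  assumes "D i j"
  shows "\<iota> (e i) \<otimes>\<^bsub>U\<^esub> \<iota> (e j) = \<iota> (e j) \<otimes>\<^bsub>U\<^esub> \<iota> (e i)" (is "?x = ?y")
proof -
  have ij: "i \<in> I" "j \<in> I" "A i j = 0" using assms by (auto simp: D_def)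
  have "e i \<otimes>\<^bsub>\<g>\<^esub> e j = \<zero>\<^bsub>\<g>\<^esub>"
  proof -
    have "(Mult (Gen (e_gen i)) (Gen (e_gen j)), Zero) \<in> borcherds_ids I A"
      using ij by (simp add: borcherds_ids_def borcherds_rels.intros)
    then show ?thesis
      using ij by (simp add: chevalley_e_def g_simps e_term g.term_class_ident lie_terms.intros)
  qed
  then have "?x \<oplus>\<^bsub>U\<^esub> (- 1) \<odot>\<^bsub>U\<^esub> ?y = \<zero>\<^bsub>U\<^esub>"
    using \<iota>_hom(3)[of "e i" "e j"] ij by (simp add: \<iota>_zero)
  moreover have "?x \<in> carrier U" "?y \<in> carrier U" using ij by auto
  moreover have "(- 1) \<odot>\<^bsub>U\<^esub> ?y = \<ominus>\<^bsub>U\<^esub> ?y"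
    using U.V.smult_minus_1[of ?y] ij by (simp add: class_ring_simps)
  ultimately show ?thesis
    by (metis U.V.minus_equality U.V.minus_minus U.V.a_inv_closed)
qed

section \<open>Words in the e_i span the homogeneous components\<close>

primrec word :: "'i list \<Rightarrow> 'i chevalley_gen alg_term set alg_term set" where
  "word [] = \<one>\<^bsub>U\<^esub>"
| "word (i # w) = \<iota> (e i) \<otimes>\<^bsub>U\<^esub> word w"

lemma word_closed [simp]: "set w \<subseteq> I \<Longrightarrow> word w \<in> carrier U"
  by (induction w) auto

lemma word_append: "set u \<subseteq> I \<Longrightarrow> set v \<subseteq> I \<Longrightarrow> word (u @ v) = word u \<otimes>\<^bsub>U\<^esub> word v"
  by (induction u) (auto simp: U.P_assoc)

lemma word_swap: "swap u v \<Longrightarrow> set u \<subseteq> I \<Longrightarrow> word u = word v"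
proof (induction rule: swap.induct)
  case (1 i j u v)
  then have "word (i # j # v) = word (j # i # v)"
    using e_commute[OF 1(1)] by (simp flip: U.P_assoc)
  then show ?case using 1 by (simp add: word_append)
qed

lemma word_trace_eq: "swap\<^sup>*\<^sup>* u v \<Longrightarrow> set u \<subseteq> I \<Longrightarrow> word u = word v"
proof (induction rule: rtranclp_induct)
  case (step v w)
  then have "set v \<subseteq> I" using trace_eq_mset by (metis set_mset_mset)
  then show ?case using step word_swap by simp
qed simp

definition words :: "'i multiset \<Rightarrow> 'i list set" where
  "words \<alpha> = {w. mset w = \<alpha> \<and> set w \<subseteq> I}"

lemma word_words_closed: "word ` words \<alpha> \<subseteq> carrier U"
  by (auto simp: words_def)

lemma linear_span_words_mult:
  assumes "x \<in> linear_span U (word ` words \<alpha>)" "y \<in> linear_span U (word ` words \<beta>)"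
  shows "x \<otimes>\<^bsub>U\<^esub> y \<in> linear_span U (word ` words (\<alpha> + \<beta>))"
proof -
  have "{b \<otimes>\<^bsub>U\<^esub> c | b c. b \<in> word ` words \<alpha> \<and> c \<in> word ` words \<beta>} \<subseteq> word ` words (\<alpha> + \<beta>)"
  proof clarify
    fix u v assume uv: "u \<in> words \<alpha>" "v \<in> words \<beta>"
    then have "word u \<otimes>\<^bsub>U\<^esub> word v = word (u @ v)" "u @ v \<in> words (\<alpha> + \<beta>)"
      by (auto simp: words_def word_append)
    then show "word u \<otimes>\<^bsub>U\<^esub> word v \<in> word ` words (\<alpha> + \<beta>)" by simp
  qed
  then show ?thesis
    by (rule subsetD[OF linear_span_mono U.linear_span_mult[OF assms word_words_closed word_words_closed]])
qed

text \<open>A bracket becomes x y - y x in the enveloping algebra, and both products are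
  combinations of words of the same degree, since multiset union is commutative. Membership in the
  carrier is proved alongside because \<open>\<iota>_hom\<close> asks for it.\<close>

lemma n_plus_part_words:
  assumes "x \<in> n_plus_part I A \<alpha>"
  shows "x \<in> carrier \<n> \<and> \<iota> x \<in> linear_span U (word ` words \<alpha>)"
proof -
  have "homogeneous \<n> {(e i, {#i#}) | i. i \<in> I} \<alpha> x"
    using assms by (simp add: n_plus_part_def)
  then show ?thesis
  proof induction
    case (1 x \<alpha>)
    then obtain i where i: "x = e i" "\<alpha> = {#i#}" "i \<in> I" by auto
    then have "\<iota> x = word [i]" by simp
    moreover have "[i] \<in> words \<alpha>" using i by (simp add: words_def)
    ultimately have "\<iota> x \<in> word ` words \<alpha>" by (rule image_eqI)
    then show ?case using i by (simp add: linear_span.base)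
  next
    case (2 \<alpha>)
    then show ?case by (simp add: \<iota>_zero linear_span.zero)
  next
    case (3 \<alpha> x y)
    then show ?case by (simp add: \<iota>_hom linear_span.add)
  next
    case (4 \<alpha> x c)
    then show ?case by (simp add: \<iota>_hom(2)[of _ x] linear_span.smult)
  next
    case (5 \<alpha> x \<beta> y)
    then show ?case
      using linear_span_words_mult[of "\<iota> x" \<alpha> "\<iota> y" \<beta>] linear_span_words_mult[of "\<iota> y" \<beta> "\<iota> x" \<alpha>]
      by (simp add: \<iota>_hom(3) linear_span.add linear_span.smult add.commute)
  qed
qed

lemma enveloping_part_words:
  assumes "u \<in> enveloping_part \<n> (n_plus_part I A) \<alpha>"
  shows "u \<in> linear_span U (word ` words \<alpha>)"
proof -
  have "homogeneous U (insert (\<one>\<^bsub>U\<^esub>, {#}) {(\<iota> x, \<beta>) | x \<beta>. x \<in> n_plus_part I A \<beta>}) \<alpha> u"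
    using assms by (simp add: enveloping_part_def)
  then show ?thesis
  proof induction
    case (1 x \<alpha>)
    have "\<one>\<^bsub>U\<^esub> \<in> word ` words {#}"
      by (rule image_eqI[of _ _ "[]"]) (simp_all add: words_def)
    then show ?case using 1 n_plus_part_words by (auto intro: linear_span.base)
  qed (auto intro: linear_span.intros linear_span_words_mult)
qed

lemma word_enveloping_part:
  "set w \<subseteq> I \<Longrightarrow> word w \<in> enveloping_part \<n> (n_plus_part I A) (mset w)"
proof (induction w)
  case Nil
  show ?case by (auto simp: enveloping_part_def intro: homogeneous.intros)
next
  case (Cons i w)
  have "e i \<in> n_plus_part I A {#i#}"
    using Cons.prems by (auto simp: n_plus_part_def intro: homogeneous.intros)
  then have "\<iota> (e i) \<in> enveloping_part \<n> (n_plus_part I A) {#i#}"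
    by (auto simp: enveloping_part_def intro: homogeneous.intros)
  then have "\<iota> (e i) \<otimes>\<^bsub>U\<^esub> word w \<in> enveloping_part \<n> (n_plus_part I A) ({#i#} + mset w)"
    using Cons unfolding enveloping_part_def mem_Collect_eq by (intro homogeneous.intros(5)) auto
  then show ?case by simp
qed


section \<open>The dual action of the enveloping algebra\<close>

text \<open>An element of n^+ is a class of Lie terms and acts through a chosen one of them; on
  invariant functions \<open>lie_op_cong\<close> makes the choice immaterial.\<close>

primrec env_op ::
    "'i chevalley_gen alg_term set alg_term \<Rightarrow> ('i list \<Rightarrow> complex) \<Rightarrow> 'i list \<Rightarrow> complex" where
  "env_op (Gen x) F = lie_op A (SOME t. t \<in> x) F"
| "env_op Zero F = (\<lambda>w. 0)"
| "env_op One F = F"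
| "env_op (Add s t) F = (\<lambda>w. env_op s F w + env_op t F w)"
| "env_op (Smult c t) F = (\<lambda>w. c * env_op t F w)"
| "env_op (Mult s t) F = env_op t (env_op s F)"

lemma env_op_linear:
  "env_op t (\<lambda>w. a * F w + b * G w) = (\<lambda>w. a * env_op t F w + b * env_op t G w)"
  by (induction t arbitrary: a b F G) (auto simp: lie_op_linear algebra_simps)

lemma env_op_add: "env_op t (\<lambda>w. F w + G w) = (\<lambda>w. env_op t F w + env_op t G w)"
  using env_op_linear[of t 1 F 1 G] by simp

lemma env_op_scale: "env_op t (\<lambda>w. c * F w) = (\<lambda>w. c * env_op t F w)"
  using env_op_linear[of t c F 0 F] by simp

lemma invariant_env_op: "invariant F \<Longrightarrow> invariant (env_op t F)"
proof (induction t arbitrary: F)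
  case (Add s t) then show ?case by (auto simp: invariant_def)
next
  case (Smult c t) then show ?case by (auto simp: invariant_def)
qed (auto simp: invariant_lie_op invariant_def[of "\<lambda>w. 0"])

lemma lie_op_some:
  assumes "t \<in> lie_terms (chevalley_gens I)" "invariant F"
  shows "lie_op A (SOME s. s \<in> term_class (lie_terms (chevalley_gens I)) (borcherds_ids I A) t) F = lie_op A t F"
  using term_cong_some[OF assms(1)] assms(2) by (rule lie_op_cong)

lemma env_op_Gen:
  assumes "x \<in> carrier \<g>" "y \<in> carrier \<g>" "invariant F"
  shows "env_op (Gen (x \<oplus>\<^bsub>\<g>\<^esub> y)) F = (\<lambda>w. env_op (Gen x) F w + env_op (Gen y) F w)"
    and "env_op (Gen (c \<odot>\<^bsub>\<g>\<^esub> x)) F = (\<lambda>w. c * env_op (Gen x) F w)"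
    and "env_op (Gen (x \<otimes>\<^bsub>\<g>\<^esub> y)) F =
      (\<lambda>w. env_op (Gen y) (env_op (Gen x) F) w - env_op (Gen x) (env_op (Gen y) F) w)"
proof -
  obtain s t where "s \<in> lie_terms (chevalley_gens I)" "t \<in> lie_terms (chevalley_gens I)"
    "x = term_class (lie_terms (chevalley_gens I)) (borcherds_ids I A) s"
    "y = term_class (lie_terms (chevalley_gens I)) (borcherds_ids I A) t"
    using assms by (auto simp: carrier_g)
  then show "env_op (Gen (x \<oplus>\<^bsub>\<g>\<^esub> y)) F = (\<lambda>w. env_op (Gen x) F w + env_op (Gen y) F w)"
    and "env_op (Gen (c \<odot>\<^bsub>\<g>\<^esub> x)) F = (\<lambda>w. c * env_op (Gen x) F w)"
    and "env_op (Gen (x \<otimes>\<^bsub>\<g>\<^esub> y)) F =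
      (\<lambda>w. env_op (Gen y) (env_op (Gen x) F) w - env_op (Gen x) (env_op (Gen y) F) w)"
    using assms(3) by (simp_all add: g_simps lie_op_some lie_terms.intros invariant_lie_op)
qed

lemma env_op_enveloping_ids:
  assumes "(s, t) \<in> enveloping_ids \<n>" "invariant F"
  shows "env_op s F = env_op t F"
proof -
  consider "(s, t) \<in> vector_space_ids" | "(s, t) \<in> bilinear_ids" | "(s, t) \<in> assoc_ids" |
    "(s, t) \<in> enveloping_rels \<n>"
    using assms(1) by (auto simp: enveloping_ids_def)
  then show ?thesis
  proof cases
    case 1 then show ?thesis by cases (auto simp: algebra_simps)
  next
    case 2 then show ?thesis by cases (auto simp: algebra_simps env_op_add env_op_scale)
  next
    case 3 then show ?thesis by cases auto
  next
    case 4
    then show ?thesis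
    proof cases
      case (1 x y)
      then show ?thesis
        using n_plus_subset by (simp add: env_op_Gen(1) subset_iff assms(2) del: env_op.simps(1))
    next
      case (2 x c)
      then show ?thesis
        using n_plus_subset by (simp add: env_op_Gen(2)[of x x] subset_iff assms(2) del: env_op.simps(1))
    next
      case (3 x y)
      then show ?thesis
        using n_plus_subset by (simp add: env_op_Gen(3) subset_iff assms(2) del: env_op.simps(1))
    qed
  qed
qed

lemma env_op_cong:
  "term_cong T (enveloping_ids \<n>) s t \<Longrightarrow> invariant F \<Longrightarrow> env_op s F = env_op t F"
proof (induction arbitrary: F rule: term_cong.induct)
  case (mult s s' t t')
  then show ?case by (simp add: invariant_env_op)
qed (auto simp: env_op_enveloping_ids)

text \<open>A matrix coefficient: the linear form \<open>F\<close> at the image under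
  \<open>u\<close> of the lowest weight vector, which is the empty word.\<close>

definition pairing :: "'i chevalley_gen alg_term set alg_term set \<Rightarrow> ('i list \<Rightarrow> complex) \<Rightarrow> complex" where
  "pairing u F = env_op (SOME t. t \<in> u) F []"

lemma pairing_class:
  assumes "t \<in> assoc_terms (carrier \<n>)" "invariant F"
  shows "pairing (term_class (assoc_terms (carrier \<n>)) (enveloping_ids \<n>) t) F = env_op t F []"
  unfolding pairing_def using term_cong_some[OF assms(1)] assms(2) by (subst env_op_cong) auto

lemma pairing_linear:
  assumes "u \<in> carrier U" "v \<in> carrier U" "invariant F"
  shows "pairing (u \<oplus>\<^bsub>U\<^esub> v) F = pairing u F + pairing v F"
    and "pairing (c \<odot>\<^bsub>U\<^esub> u) F = c * pairing u F"
proof -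
  obtain s t where "s \<in> assoc_terms (carrier \<n>)" "t \<in> assoc_terms (carrier \<n>)"
    "u = term_class (assoc_terms (carrier \<n>)) (enveloping_ids \<n>) s"
    "v = term_class (assoc_terms (carrier \<n>)) (enveloping_ids \<n>) t"
    using assms by (auto simp: U.carrier_P)
  then show "pairing (u \<oplus>\<^bsub>U\<^esub> v) F = pairing u F + pairing v F"
    and "pairing (c \<odot>\<^bsub>U\<^esub> u) F = c * pairing u F"
    using assms(3) by (simp_all add: U.P_simps pairing_class)
qed

lemma pairing_word:
  assumes "set w \<subseteq> I" "invariant F"
  shows "pairing (word w) F = F w"
proof -
  \<comment> \<open>A representative is built along the word, because \<open>env_op\<close> recurses
    on terms and \<open>word w\<close> is a class. The claim covers all invariant \<open>F\<close>,
    as the hypothesis for \<open>w\<close> is applied to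
    \<open>\<lambda>v. F (i # v)\<close>.\<close>
  have "\<exists>t\<in>assoc_terms (carrier \<n>).
      word w = term_class (assoc_terms (carrier \<n>)) (enveloping_ids \<n>) t \<and>
      (\<forall>F. invariant F \<longrightarrow> env_op t F = (\<lambda>v. F (w @ v)))"
    using assms(1)
  proof (induction w)
    case Nil
    show ?case by (rule bexI[of _ One]) (auto simp: U.one_presented)
  next
    case (Cons i w)
    then obtain t where t: "t \<in> assoc_terms (carrier \<n>)"
      "word w = term_class (assoc_terms (carrier \<n>)) (enveloping_ids \<n>) t"
      "\<And>F. invariant F \<Longrightarrow> env_op t F = (\<lambda>v. F (w @ v))"
      by auto
    have i: "i \<in> I" using Cons.prems by simp
    have "env_op (Gen (e i)) F = (\<lambda>v. F (i # v))" if "invariant F" for F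
      using lie_op_some[OF e_term[OF i] that] by (simp add: chevalley_e_def)
    then have "env_op (Mult (Gen (e i)) t) F = (\<lambda>v. F ((i # w) @ v))" if "invariant F" for F
      using that t(3)[OF invariant_Cons[OF that]] by simp
    then show ?case
      using t(1,2) i by (intro bexI[of _ "Mult (Gen (e i)) t"]) (auto simp: \<iota>_class U.mult_P)
  qed
  then show ?thesis using pairing_class assms(2) by fastforce
qed


section \<open>Tensor powers\<close>

abbreviation "tensor_terms q \<equiv> linear_terms (tensor_gens q U)"
abbreviation "tensor_ids q \<equiv> vector_space_ids \<union> tensor_rels q U"

lemma presentation_tensor: "presentation (tensor_terms q) (tensor_ids q)"
  by unfold_locales (auto intro: linear_terms.intros)

lemma carrier_tensor: "carrier (tensor_power q U) = term_class (tensor_terms q) (tensor_ids q) ` tensor_terms q"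
  by (simp add: tensor_power_def presented_algebra_def)

text \<open>The tensor product of the linear forms given by pairing with the members of
  \<open>Fs\<close>, described on terms.\<close>

primrec tensor_val ::
    "('i list \<Rightarrow> complex) list \<Rightarrow> 'i chevalley_gen alg_term set alg_term set list alg_term \<Rightarrow> complex" where
  "tensor_val Fs (Gen us) = (\<Prod>k<length Fs. pairing (us ! k) (Fs ! k))"
| "tensor_val Fs Zero = 0"
| "tensor_val Fs One = 0"
| "tensor_val Fs (Add s t) = tensor_val Fs s + tensor_val Fs t"
| "tensor_val Fs (Smult c t) = c * tensor_val Fs t"
| "tensor_val Fs (Mult s t) = 0"

lemma tensor_val_update:
  assumes "k < length Fs" "length us = length Fs"
  shows "tensor_val Fs (Gen (us[k := u])) =
    pairing u (Fs ! k) * (\<Prod>l\<in>{..<length Fs} - {k}. pairing (us ! l) (Fs ! l))"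
  using assms by (simp add: prod.remove[of _ k])

lemma tensor_val_tensor_rels:
  assumes "(s, t) \<in> tensor_rels q U" "length Fs = q" "\<forall>F\<in>set Fs. invariant F"
  shows "tensor_val Fs s = tensor_val Fs t"
  using assms(1)
proof cases
  case (1 us k u v)
  then have "invariant (Fs ! k)" "k < length Fs" "length us = length Fs"
    using assms by (auto simp: tensor_gens_def)
  then show ?thesis
    using 1 by (simp add: tensor_val_update pairing_linear distrib_right del: tensor_val.simps(1))
next
  case (2 us k u c)
  then have "invariant (Fs ! k)" "k < length Fs" "length us = length Fs"
    using assms by (auto simp: tensor_gens_def)
  then show ?thesis
    using 2 by (simp add: tensor_val_update pairing_linear(2)[of u u] del: tensor_val.simps(1))
qed

lemma tensor_val_cong:
  assumes "term_cong (tensor_terms q) (tensor_ids q) s t" "length Fs = q" "\<forall>F\<in>set Fs. invariant F"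
  shows "tensor_val Fs s = tensor_val Fs t"
  using assms
proof (induction rule: term_cong.induct)
  case (ident s t)
  then consider "(s, t) \<in> vector_space_ids" | "(s, t) \<in> tensor_rels q U" by auto
  then show ?case
  proof cases
    case 1 then show ?thesis by cases (auto simp: algebra_simps)
  next
    case 2 then show ?thesis by (rule tensor_val_tensor_rels) (use ident in auto)
  qed
qed auto

definition tensor_pairing where
  "tensor_pairing Fs v = tensor_val Fs (SOME t. t \<in> v)"

lemma tensor_pairing_class:
  assumes "t \<in> tensor_terms q" "length Fs = q" "\<forall>F\<in>set Fs. invariant F"
  shows "tensor_pairing Fs (term_class (tensor_terms q) (tensor_ids q) t) = tensor_val Fs t"
  unfolding tensor_pairing_def using term_cong_some[OF assms(1)] assms(2,3)
  by (subst tensor_val_cong) auto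

lemma tensor_pairing_linear:
  assumes "u \<in> carrier (tensor_power q U)" "v \<in> carrier (tensor_power q U)"
    "length Fs = q" "\<forall>F\<in>set Fs. invariant F"
  shows "tensor_pairing Fs (u \<oplus>\<^bsub>tensor_power q U\<^esub> v) = tensor_pairing Fs u + tensor_pairing Fs v"
    and "tensor_pairing Fs (c \<odot>\<^bsub>tensor_power q U\<^esub> u) = c * tensor_pairing Fs u"
    and "tensor_pairing Fs \<zero>\<^bsub>tensor_power q U\<^esub> = 0"
proof -
  interpret T: presentation "tensor_terms q" "tensor_ids q" by (rule presentation_tensor)
  obtain s t where "s \<in> tensor_terms q" "t \<in> tensor_terms q" "u = term_class (tensor_terms q) (tensor_ids q) s" "v = term_class (tensor_terms q) (tensor_ids q) t"
    using assms by (auto simp: carrier_tensor)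
  then show "tensor_pairing Fs (u \<oplus>\<^bsub>tensor_power q U\<^esub> v) = tensor_pairing Fs u + tensor_pairing Fs v"
    and "tensor_pairing Fs (c \<odot>\<^bsub>tensor_power q U\<^esub> u) = c * tensor_pairing Fs u"
    and "tensor_pairing Fs \<zero>\<^bsub>tensor_power q U\<^esub> = 0"
    using assms(3,4) by (simp_all add: tensor_power_def T.add_presented T.smult_presented
        T.zero_presented tensor_pairing_class)
qed

lemma pure_tensor_closed:
  "length us = q \<Longrightarrow> set us \<subseteq> carrier U \<Longrightarrow> pure_tensor q U us \<in> carrier (tensor_power q U)"
  by (auto simp: pure_tensor_def carrier_tensor tensor_gens_def intro!: linear_terms.intros imageI)

lemma tensor_pairing_pure_words:
  assumes "length ws = q" "length Fs = q" "\<forall>F\<in>set Fs. invariant F" "\<forall>w\<in>set ws. set w \<subseteq> I"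
  shows "tensor_pairing Fs (pure_tensor q U (map word ws)) = (\<Prod>k<q. (Fs ! k) (ws ! k))"
proof -
  have "Gen (map word ws) \<in> tensor_terms q"
    using assms by (auto simp: tensor_gens_def intro!: linear_terms.intros)
  then have "tensor_pairing Fs (pure_tensor q U (map word ws)) = tensor_val Fs (Gen (map word ws))"
    unfolding pure_tensor_def using assms by (intro tensor_pairing_class)
  also have "\<dots> = (\<Prod>k<q. (Fs ! k) (ws ! k))"
    using assms by (auto intro!: prod.cong pairing_word)
  finally show ?thesis .
qed

lemma pure_tensor_linear:
  assumes "length us = q" "set us \<subseteq> carrier U" "k < q" "u \<in> carrier U" "v \<in> carrier U"
  shows "pure_tensor q U (us[k := u \<oplus>\<^bsub>U\<^esub> v]) =
      pure_tensor q U (us[k := u]) \<oplus>\<^bsub>tensor_power q U\<^esub> pure_tensor q U (us[k := v])"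
    and "pure_tensor q U (us[k := c \<odot>\<^bsub>U\<^esub> u]) =
      c \<odot>\<^bsub>tensor_power q U\<^esub> pure_tensor q U (us[k := u])"
proof -
  interpret T: presentation "tensor_terms q" "tensor_ids q" by (rule presentation_tensor)
  have us: "us \<in> tensor_gens q U" using assms by (simp add: tensor_gens_def)
  have "Gen (us[k := x]) \<in> tensor_terms q" if "x \<in> carrier U" for x
    using assms that set_update_subset_insert[of us k x]
    by (intro linear_terms.intros) (auto simp: tensor_gens_def)
  then show "pure_tensor q U (us[k := u \<oplus>\<^bsub>U\<^esub> v]) =
      pure_tensor q U (us[k := u]) \<oplus>\<^bsub>tensor_power q U\<^esub> pure_tensor q U (us[k := v])"
    and "pure_tensor q U (us[k := c \<odot>\<^bsub>U\<^esub> u]) =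
      c \<odot>\<^bsub>tensor_power q U\<^esub> pure_tensor q U (us[k := u])"
    using tensor_rels.intros[OF us assms(3,4)] assms(4,5)
    by (simp_all add: pure_tensor_def tensor_power_def T.add_presented T.smult_presented
        T.term_class_ident)
qed

text \<open>Multilinear expansion, carried out one slot at a time.\<close>

lemma pure_tensor_linear_span:
  assumes "length us = q" "\<And>k. k < q \<Longrightarrow> us ! k \<in> linear_span U (B k)"
    and B: "\<And>k. k < q \<Longrightarrow> B k \<subseteq> carrier U"
  shows "pure_tensor q U us \<in> linear_span (tensor_power q U)
    {pure_tensor q U vs | vs. length vs = q \<and> (\<forall>k<q. vs ! k \<in> B k)}" (is "_ \<in> ?S")
proof -
  interpret T: presentation "tensor_terms q" "tensor_ids q" by (rule presentation_tensor)
  have span: "linear_span U (B k) \<subseteq> carrier U" if "k < q" for k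
    using B[OF that] by (rule U.linear_span_carrier)
  \<comment> \<open>Here \<open>n\<close> counts the leading slots whose entries may be
    combinations, the later ones being generators already; \<open>n = 0\<close> is a base element of
    the span, and \<open>n = q\<close> is the claim.\<close>
  have "pure_tensor q U us \<in> ?S"
    if "n \<le> q" "length us = q" "\<forall>k<n. us ! k \<in> linear_span U (B k)" "\<forall>k. n \<le> k \<and> k < q \<longrightarrow> us ! k \<in> B k"
    for us n
    using that
  proof (induction n arbitrary: us)
    case 0
    then show ?case by (intro linear_span.base) auto
  next
    case (Suc n)
    have len: "length us = q" "n < q" using Suc.prems by auto
    have car: "set us \<subseteq> carrier U"
    proof
      fix x assume "x \<in> set us"
      then obtain k where "k < q" "x = us ! k" using len by (auto simp: in_set_conv_nth)
      then show "x \<in> carrier U"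
        using Suc.prems span[of k] B[of k] by (cases "k < Suc n") auto
    qed
    have "pure_tensor q U (us[n := x]) \<in> ?S" if "x \<in> linear_span U (B n)" for x
      using that
    proof induction
      case (base x)
      show ?case
      proof (rule Suc.IH)
        show "\<forall>k<n. us[n := x] ! k \<in> linear_span U (B k)"
          using Suc.prems by auto
        show "\<forall>k. n \<le> k \<and> k < q \<longrightarrow> us[n := x] ! k \<in> B k"
          using Suc.prems base len by (auto simp: nth_list_update)
      qed (use Suc.prems in auto)
    next
      case zero
      \<comment> \<open>Pulling the scalar 0 out of slot \<open>n\<close> exhibits the tensor as 0
        times itself.\<close>
      have "pure_tensor q U (us[n := \<zero>\<^bsub>U\<^esub>]) = 0 \<odot>\<^bsub>tensor_power q U\<^esub> pure_tensor q U (us[n := \<zero>\<^bsub>U\<^esub>])"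
        using pure_tensor_linear(2)[OF len(1) car len(2), of "\<zero>\<^bsub>U\<^esub>" "\<zero>\<^bsub>U\<^esub>" 0]
        by (simp add: U.zero_smult_presented)
      also have "\<dots> = \<zero>\<^bsub>tensor_power q U\<^esub>"
        unfolding tensor_power_def
        using pure_tensor_closed[of "us[n := \<zero>\<^bsub>U\<^esub>]" q] len car set_update_subset_insert[of us n "\<zero>\<^bsub>U\<^esub>"]
        by (intro T.zero_smult_presented) (auto simp: tensor_power_def)
      finally show ?case by (simp add: linear_span.zero)
    next
      case (add x y)
      then have "x \<in> carrier U" "y \<in> carrier U" using span[OF len(2)] by auto
      then show ?case
        using add.IH pure_tensor_linear(1)[OF len(1) car len(2), of x y] by (simp add: linear_span.add)
    next
      case (smult x c)
      then have "x \<in> carrier U" using span[OF len(2)] by auto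
      then show ?case
        using smult.IH pure_tensor_linear(2)[OF len(1) car len(2), of x x c] by (simp add: linear_span.smult)
    qed
    from this[of "us ! n"] show ?case
      using Suc.prems by simp
  qed
  from this[of q us] show ?thesis using assms by (auto simp flip: not_less)
qed

section \<open>A basis of each graded component\<close>

definition tensor_basis where
  "tensor_basis q \<alpha> = (\<lambda>ws. pure_tensor q U (map word ws)) ` trace_lists q \<alpha>"

lemma trace_lists_subset:
  assumes "\<alpha> \<in> Q_plus I" "ws \<in> trace_lists q \<alpha>"
  shows "\<forall>w\<in>set ws. set w \<subseteq> I"
proof
  fix w assume "w \<in> set ws"
  then have "mset w \<subseteq># \<alpha>"
    using assms mset_subseteq_sum_list[of w ws mset] by (auto simp: trace_lists_def)
  then show "set w \<subseteq> I"
    using assms set_mset_mono by (fastforce simp: Q_plus_def)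
qed

text \<open>The indicator of a trace is invariant because \<open>nf\<close> is constant on classes,
  so these forms are a dual family to the pure tensors of traces. The count in
  \<open>card_tensor_basis\<close> and the independence in \<open>tensor_basis_indpt\<close> both
  rest on it.\<close>

lemma indicator_pairing:
  assumes "\<alpha> \<in> Q_plus I" "ws \<in> trace_lists q \<alpha>" "vs \<in> trace_lists q \<alpha>"
  shows "tensor_pairing (map (\<lambda>v w. of_bool (nf w = v)) vs) (pure_tensor q U (map word ws)) = of_bool (ws = vs)"
proof -
  have inv: "invariant (\<lambda>w. of_bool (nf w = v))" for v
    by (auto simp: invariant_def nf_eq_iff[THEN iffD2, OF r_into_rtranclp])
  have len: "length ws = q" "length vs = q" using assms by (auto simp: trace_lists_def)
  have "tensor_pairing (map (\<lambda>v w. of_bool (nf w = v)) vs) (pure_tensor q U (map word ws)) =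
      (\<Prod>k<q. of_bool (nf (ws ! k) = vs ! k))"
    using len inv trace_lists_subset[OF assms(1,2)] by (subst tensor_pairing_pure_words) auto
  also have "\<dots> = (\<Prod>k<q. of_bool (ws ! k = vs ! k))"
    using assms(2) len by (intro prod.cong) (auto simp: trace_lists_def)
  also have "\<dots> = of_bool (ws = vs)"
    using len by (auto simp: of_bool_def list_eq_iff_nth_eq)
  finally show ?thesis .
qed

lemma tensor_power_vectorspace: "vectorspace class_ring (tensor_power q U)"
  unfolding tensor_power_def by (rule presentation.vectorspace_presented[OF presentation_tensor])

lemma tensor_basis_closed: "\<alpha> \<in> Q_plus I \<Longrightarrow> tensor_basis q \<alpha> \<subseteq> carrier (tensor_power q U)"
proof -
  assume "\<alpha> \<in> Q_plus I"
  have "pure_tensor q U (map word ws) \<in> carrier (tensor_power q U)" if "ws \<in> trace_lists q \<alpha>" for ws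
    using trace_lists_subset[OF \<open>\<alpha> \<in> Q_plus I\<close> that] that
    by (intro pure_tensor_closed) (auto simp: trace_lists_def)
  then show ?thesis by (auto simp: tensor_basis_def)
qed

lemma card_tensor_basis: "\<alpha> \<in> Q_plus I \<Longrightarrow> card (tensor_basis q \<alpha>) = card (trace_lists q \<alpha>)"
proof -
  assume \<alpha>: "\<alpha> \<in> Q_plus I"
  have "inj_on (\<lambda>ws. pure_tensor q U (map word ws)) (trace_lists q \<alpha>)"
  proof (rule inj_onI)
    fix ws vs assume "ws \<in> trace_lists q \<alpha>" "vs \<in> trace_lists q \<alpha>"
      "pure_tensor q U (map word ws) = pure_tensor q U (map word vs)"
    then show "ws = vs"
      using indicator_pairing[OF \<alpha>, of ws q vs] indicator_pairing[OF \<alpha>, of vs q vs] by simp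
  qed
  then show ?thesis unfolding tensor_basis_def by (rule card_image)
qed

lemma tensor_pairing_lincomb:
  assumes "finite B" "B \<subseteq> carrier (tensor_power q U)" "length Fs = q" "\<forall>F\<in>set Fs. invariant F"
  shows "tensor_pairing Fs (LinearCombinations.module.lincomb (tensor_power q U) a B) =
    (\<Sum>b\<in>B. a b * tensor_pairing Fs b)"
proof -
  interpret V: vectorspace class_ring "tensor_power q U" by (rule tensor_power_vectorspace)
  show ?thesis
    using assms(1,2)
  proof (induction B)
    case empty
    then show ?case by (simp add: V.lincomb_def tensor_pairing_linear(3)[OF V.M.zero_closed V.M.zero_closed] assms)
  next
    case (insert b B)
    have "V.lincomb a (insert b B) = a b \<odot>\<^bsub>tensor_power q U\<^esub> b \<oplus>\<^bsub>tensor_power q U\<^esub> V.lincomb a B"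
      unfolding V.lincomb_def using insert by (subst V.M.finsum_insert) auto
    moreover have "V.lincomb a B \<in> carrier (tensor_power q U)"
      using insert by (intro V.lincomb_closed) auto
    ultimately show ?case
      using insert assms by (simp add: tensor_pairing_linear(1) tensor_pairing_linear(2)[of b q b])
  qed
qed

lemma tensor_basis_indpt:
  assumes "\<alpha> \<in> Q_plus I"
  shows "LinearCombinations.module.lin_indpt class_ring (tensor_power q U) (tensor_basis q \<alpha>)"
proof -
  interpret V: vectorspace class_ring "tensor_power q U" by (rule tensor_power_vectorspace)
  have fin: "finite (tensor_basis q \<alpha>)" by (simp add: tensor_basis_def)
  show ?thesis
  proof (rule V.finite_lin_indpt2[OF fin tensor_basis_closed[OF assms]])
    fix a assume a: "V.lincomb a (tensor_basis q \<alpha>) = \<zero>\<^bsub>tensor_power q U\<^esub>"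
    show "\<forall>b\<in>tensor_basis q \<alpha>. a b = \<zero>\<^bsub>class_ring\<^esub>"
    proof
      fix b assume b: "b \<in> tensor_basis q \<alpha>"
      then obtain vs where vs: "vs \<in> trace_lists q \<alpha>" "b = pure_tensor q U (map word vs)"
        by (auto simp: tensor_basis_def)
      \<comment> \<open>The form dual to \<open>b\<close>: on the vanishing combination it returns
        the coefficient \<open>a b\<close>.\<close>
      let ?Fs = "map (\<lambda>v w. of_bool (nf w = v)) vs :: ('i list \<Rightarrow> complex) list"
      have Fs: "length ?Fs = q" "\<forall>F\<in>set ?Fs. invariant F"
        using vs by (auto simp: trace_lists_def invariant_def nf_eq_iff[THEN iffD2, OF r_into_rtranclp])
      have "0 = tensor_pairing ?Fs (V.lincomb a (tensor_basis q \<alpha>))"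
        using a tensor_pairing_linear(3)[OF V.M.zero_closed V.M.zero_closed Fs] by simp
      also have "\<dots> = (\<Sum>c\<in>tensor_basis q \<alpha>. a c * tensor_pairing ?Fs c)"
        using tensor_pairing_lincomb[OF fin tensor_basis_closed[OF assms] Fs] .
      also have "\<dots> = (\<Sum>c\<in>tensor_basis q \<alpha>. if c = b then a c else 0)"
      proof (rule sum.cong)
        fix c assume "c \<in> tensor_basis q \<alpha>"
        then obtain ws where ws: "ws \<in> trace_lists q \<alpha>" "c = pure_tensor q U (map word ws)"
          by (auto simp: tensor_basis_def)
        then show "a c * tensor_pairing ?Fs c = (if c = b then a c else 0)"
          using vs indicator_pairing[OF assms ws(1) vs(1)] indicator_pairing[OF assms vs(1) vs(1)]
          by auto
      qed simp
      also have "\<dots> = a b" using b fin by simp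
      finally show "a b = \<zero>\<^bsub>class_ring\<^esub>" by simp
    qed
  qed
qed

text \<open>Homogeneous entries expand into words, and a word has the same value as its normal form
  because commuting letters commute in the enveloping algebra. The degrees of the slots may vary,
  with only their sum fixed, which is how \<open>trace_lists\<close> counts.\<close>

lemma tensor_part_eq_span:
  assumes "\<alpha> \<in> Q_plus I"
  shows "U_tensor_part I A q \<alpha> = LinearCombinations.module.span class_ring (tensor_power q U) (tensor_basis q \<alpha>)"
    (is "_ = ?S")
proof -
  interpret V: vectorspace class_ring "tensor_power q U" by (rule tensor_power_vectorspace)
  let ?D = "enveloping_part \<n> (n_plus_part I A)"
  let ?P = "{pure_tensor q U xs | xs \<beta>s. length xs = q \<and> length \<beta>s = q \<and>
    (\<forall>k<q. xs ! k \<in> ?D (\<beta>s ! k)) \<and> sum_list \<beta>s = \<alpha>}"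
  have part: "U_tensor_part I A q \<alpha> = V.span ?P"
    by (simp add: U_tensor_part_def tensor_part_def)
  have "tensor_basis q \<alpha> \<subseteq> ?P"
  proof
    fix b assume "b \<in> tensor_basis q \<alpha>"
    then obtain ws where ws: "ws \<in> trace_lists q \<alpha>" "b = pure_tensor q U (map word ws)"
      by (auto simp: tensor_basis_def)
    then show "b \<in> ?P"
      using trace_lists_subset[OF assms ws(1)] word_enveloping_part
      by (auto simp: trace_lists_def intro!: exI[of _ "map word ws"] exI[of _ "map mset ws"])
  qed
  then have "V.span (tensor_basis q \<alpha>) \<subseteq> V.span ?P"
    by (rule V.span_is_monotone)
  moreover have "V.span ?P \<subseteq> V.span (tensor_basis q \<alpha>)"
  proof (rule V.span_is_subset)
    show sub: "submodule class_ring (V.span (tensor_basis q \<alpha>)) (tensor_power q U)"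
      by (rule V.span_is_submodule[OF tensor_basis_closed[OF assms]])
    show "?P \<subseteq> V.span (tensor_basis q \<alpha>)"
    proof
      fix x assume "x \<in> ?P"
      then obtain xs \<beta>s where xs: "x = pure_tensor q U xs" "length xs = q" "length \<beta>s = q"
        "\<forall>k<q. xs ! k \<in> ?D (\<beta>s ! k)" "sum_list \<beta>s = \<alpha>" by auto
      have "x \<in> linear_span (tensor_power q U)
          {pure_tensor q U vs | vs. length vs = q \<and> (\<forall>k<q. vs ! k \<in> word ` words (\<beta>s ! k))}"
        unfolding xs(1) using xs enveloping_part_words word_words_closed
        by (intro pure_tensor_linear_span) auto
      moreover have "{pure_tensor q U vs | vs. length vs = q \<and> (\<forall>k<q. vs ! k \<in> word ` words (\<beta>s ! k))} \<subseteq>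
          tensor_basis q \<alpha>"
      proof
        fix y assume "y \<in> {pure_tensor q U vs | vs. length vs = q \<and> (\<forall>k<q. vs ! k \<in> word ` words (\<beta>s ! k))}"
        then obtain vs where vs: "y = pure_tensor q U vs" "length vs = q" "\<forall>k<q. vs ! k \<in> word ` words (\<beta>s ! k)"
          by auto
        then have "\<forall>k. \<exists>w. k < q \<longrightarrow> w \<in> words (\<beta>s ! k) \<and> vs ! k = word w" by blast
        then obtain w where w: "\<And>k. k < q \<Longrightarrow> w k \<in> words (\<beta>s ! k) \<and> vs ! k = word (w k)"
          by metis
        let ?ws = "map (\<lambda>k. nf (w k)) [0..<q]"
        have "word (nf (w k)) = vs ! k" if "k < q" for k
          using w[OF that] word_trace_eq[OF trace_eq_nf] by (auto simp: words_def)
        then have "vs = map word ?ws"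
          using vs(2) by (intro nth_equalityI) auto
        moreover have "map mset ?ws = \<beta>s"
          using w xs(3) by (intro nth_equalityI) (auto simp: words_def)
        then have "?ws \<in> trace_lists q \<alpha>"
          using xs(5) by (auto simp: trace_lists_def)
        ultimately show "y \<in> tensor_basis q \<alpha>"
          unfolding tensor_basis_def vs(1) by (intro image_eqI[of _ _ ?ws]) simp_all
      qed
      ultimately show "x \<in> V.span (tensor_basis q \<alpha>)"
        using linear_span_subset_submodule[OF sub] V.in_own_span[OF tensor_basis_closed[OF assms]] by blast
    qed
  qed
  ultimately show ?thesis using part by simp
qed

text \<open>Generation and independence are transferred from the whole tensor power to the
  component, seen as a space of its own, by \<open>span_li_not_depend\<close>. The claim
  \<open>fin_dim\<close> certifies that \<open>dim\<close> is a genuine dimension.\<close>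

lemma graded_component_dim:
  assumes "\<alpha> \<in> Q_plus I"
  shows "vectorspace.fin_dim class_ring (graded_component (U_tensor I A q) (U_tensor_part I A q) \<alpha>)"
    and "vectorspace.dim class_ring (graded_component (U_tensor I A q) (U_tensor_part I A q) \<alpha>) =
      card (trace_lists q \<alpha>)"
proof -
  interpret V: vectorspace class_ring "tensor_power q U" by (rule tensor_power_vectorspace)
  let ?B = "tensor_basis q \<alpha>"
  have eq: "graded_component (U_tensor I A q) (U_tensor_part I A q) \<alpha> = V.vs (V.span ?B)"
    by (simp add: graded_component_def U_tensor_def tensor_part_eq_span assms)
  have B: "finite ?B" "?B \<subseteq> carrier (tensor_power q U)" "?B \<subseteq> V.span ?B" "V.lin_indpt ?B"
    using tensor_basis_closed[OF assms] tensor_basis_indpt[OF assms] V.in_own_span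
    by (auto simp: tensor_basis_def)
  have sub: "submodule class_ring (V.span ?B) (tensor_power q U)"
    using B by (intro V.span_is_submodule)
  interpret W: vectorspace class_ring "V.vs (V.span ?B)"
    using B(2) V.span_is_subspace V.subspace_is_vs by blast
  have gen: "W.span ?B = carrier (V.vs (V.span ?B))"
    using V.span_li_not_depend(1)[OF B(3) sub] by simp
  have li: "W.lin_indpt ?B"
    using V.span_li_not_depend(2)[OF B(3) sub] B(4) by simp
  have "W.basis ?B" using gen li B(3) by (simp add: W.basis_def)
  then have "W.dim = card ?B" using B(1) by (rule W.dim_basis[rotated])
  then show "vectorspace.dim class_ring (graded_component (U_tensor I A q) (U_tensor_part I A q) \<alpha>) =
      card (trace_lists q \<alpha>)"
    using eq card_tensor_basis[OF assms] by simp
  have "W.fin_dim" unfolding W.fin_dim_def using B gen by auto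
  then show "vectorspace.fin_dim class_ring (graded_component (U_tensor I A q) (U_tensor_part I A q) \<alpha>)"
    using eq by simp
qed

text \<open>Edges are unordered, so the symmetry of a_ij = 0 enters in matching non-edges with
  \<open>D\<close>. The parts of a clique tuple lie in \<open>I\<close> because their union is
  \<open>\<alpha>\<close>.\<close>

lemma indep_tuples_eq:
  assumes "\<alpha> \<in> Q_plus I"
  shows "indep_tuples I (graph_edges I A) m \<alpha> = clique_tuples m \<alpha>"
proof -
  have "independent_set I (graph_edges I A) S \<longleftrightarrow> pairwise D S" if "S \<subseteq> I" for S
  proof -
    have "{i, j} \<in> graph_edges I A \<longleftrightarrow> i \<noteq> j \<and> A i j \<noteq> 0" if "i \<in> I" "j \<in> I" for i j
      using that zero_sym[of i j] zero_sym[of j i] by (auto simp: graph_edges_def doubleton_eq_iff)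
    then show ?thesis
      using that by (auto simp: independent_set_def pairwise_def D_def subset_iff)
  qed
  note indep = this
  have sub: "S \<subseteq> I" if "S \<in> set Ss" "finite S" "(\<Sum>S\<leftarrow>Ss. mset_set S) = \<alpha>" for S Ss
  proof -
    have "mset_set S \<subseteq># \<alpha>" using mset_subseteq_sum_list[OF that(1), of mset_set] that(3) by simp
    then show ?thesis using set_mset_mono[of "mset_set S" \<alpha>] that(2) assms by (auto simp: Q_plus_def)
  qed
  have "(\<forall>S\<in>set Ss. S \<noteq> {} \<and> finite S \<and> independent_set I (graph_edges I A) S) \<longleftrightarrow>
      (\<forall>S\<in>set Ss. S \<noteq> {} \<and> finite S \<and> pairwise D S)" if "(\<Sum>S\<leftarrow>Ss. mset_set S) = \<alpha>" for Ss
    using indep sub[OF _ _ that] by (intro ball_cong) auto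
  then show ?thesis
    unfolding indep_tuples_def clique_tuples_def by (intro Collect_cong) metis
qed

lemma card_trace_lists_chromatic:
  assumes "\<alpha> \<in> Q_plus I"
  shows "of_nat (card (trace_lists q \<alpha>)) =
    (- 1) ^ size \<alpha> * poly (gen_chromatic_poly I (graph_edges I A) \<alpha>) (- of_nat q)"
  by (simp add: card_trace_lists signed_chromatic_def gen_chromatic_poly_def poly_sum
      poly_binomial_poly indep_tuples_eq[OF assms])

end

theorem theorem5p3:
  fixes I :: "'i set" and A :: "'i \<Rightarrow> 'i \<Rightarrow> real" and q :: nat
  assumes "borcherds_cartan_matrix I A"
    and "real_indices I A = {}"
  shows "(\<forall>\<alpha>\<in>Q_plus I.
            vectorspace.fin_dim class_ring (graded_component (U_tensor I A q) (U_tensor_part I A q) \<alpha>)) \<and>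
         hilbert_series I (U_tensor I A q) (U_tensor_part I A q) =
           (\<lambda>\<alpha>\<in>Q_plus I.
              (- 1) ^ size \<alpha> * poly (gen_chromatic_poly I (graph_edges I A) \<alpha>) (- of_nat q)) \<and>
         (\<forall>\<alpha>\<in>Q_plus I.
            of_nat (vectorspace.dim class_ring
                      (graded_component (U_tensor I A q) (U_tensor_part I A q) \<alpha>)) =
              (- 1) ^ size \<alpha> * poly (gen_chromatic_poly I (graph_edges I A) \<alpha>) (- of_nat q))"
proof -
  interpret borcherds I A
    using assms(1) by unfold_locales (auto simp: borcherds_cartan_matrix_def)
  show ?thesis
    using graded_component_dim card_trace_lists_chromatic
    by (auto simp: hilbert_series_def intro!: restrict_ext)
qed
end
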